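(* Let $\Omega_1=\mathbb{N}\cup\{0,\aleph_0\}$, let $\mathcal{Q}_2=\{\mathfrak{c}\}\times\Omega_1^3$, and let $$\mathcal{Q}_1=\{(\alpha,\beta,\gamma,\delta)\in\Omega_1^4 : \alpha+\beta+1=\delta \ \text{ or }\ (\alpha+\beta+1>\delta \text{ and } \gamma=\aleph_0)\}$$ (cardinal arithmetic). If $\mathcal{P}$ is an interval partition of type $\vartheta$, then $\vartheta\in\mathcal{Q}_1$ if $\mathcal{P}$ is countable and $\vartheta\in\mathcal{Q}_2$ if $\mathcal{P}$ is uncountable. Conversely, for every $\vartheta\in\mathcal{Q}_1\cup\mathcal{Q}_2$ there exists an interval partition of type $\vartheta$.
   Context: An interval partition is a partition of $\mathbb{R}$ into (nonempty) intervals; singletons $\{a\}=[a,a]$ count as intervals. The type of an interval partition $\mathcal{P}$ is the quadruple $(\alpha,\beta,\gamma,\delta)$ of cardinals where $\alpha$ is the number of singletons in $\mathcal{P}$, $\beta$ the number of compact intervals $[a,b]$ with $a<b$, $\gamma$ the number of half-open intervals, and $\delta$ the number of open intervals in $\mathcal{P}$. Here an interval is half-open if it is of the form $[u,v[$ or $]-v,-u]$ with $u<v$, allowing $v=\infty$ (so $[t,\infty[$ and $]-\infty,t]$ count as half-open); open intervals are $]a,b[$ with $-\infty\le a<b\le\infty$. $\mathfrak{c}=2^{\aleph_0}$. *)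

theory Defs
  imports "HOL-Analysis.Analysis" "HOL-Library.Equipollence" "HOL-Library.Extended_Nat"
begin

text \<open>Cardinal values that occur: elements of Omega_1 = N \<union> {0, aleph_0}
  (represented by enat, where \<infinity> is aleph_0, so enat addition and order are
  cardinal addition and order on Omega_1), and the continuum c.\<close>
datatype cardval = Om enat | Cont

definition has_size_cv :: "'a set \<Rightarrow> cardval \<Rightarrow> bool" where
  "has_size_cv S k \<longleftrightarrow> (case k of
      Om (enat n) \<Rightarrow> finite S \<and> card S = n
    | Om \<infinity> \<Rightarrow> countable S \<and> infinite S
    | Cont \<Rightarrow> S \<approx> (UNIV :: real set))"

definition interval_partition :: "real set set \<Rightarrow> bool" where
  "interval_partition P \<longleftrightarrow>
     (\<forall>I\<in>P. I \<noteq> {} \<and> is_interval I) \<and>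
     (\<forall>I\<in>P. \<forall>J\<in>P. I \<noteq> J \<longrightarrow> I \<inter> J = {}) \<and>
     \<Union>P = UNIV"

definition singleton_iv :: "real set \<Rightarrow> bool" where
  "singleton_iv I \<longleftrightarrow> (\<exists>a. I = {a})"

definition compact_iv :: "real set \<Rightarrow> bool" where
  "compact_iv I \<longleftrightarrow> (\<exists>a b. a < b \<and> I = {a..b})"

definition halfopen_iv :: "real set \<Rightarrow> bool" where
  "halfopen_iv I \<longleftrightarrow> (\<exists>u v. u < v \<and> (I = {u..<v} \<or> I = {u<..v}))
                      \<or> (\<exists>t. I = {t..} \<or> I = {..t})"

definition open_iv :: "real set \<Rightarrow> bool" where
  "open_iv I \<longleftrightarrow> (\<exists>a b. a < b \<and> I = {a<..<b}) \<or> (\<exists>t. I = {t<..} \<or> I = {..<t}) \<or> I = UNIV"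

definition has_type :: "real set set \<Rightarrow> cardval \<times> cardval \<times> cardval \<times> cardval \<Rightarrow> bool" where
  "has_type P \<theta> \<longleftrightarrow> (case \<theta> of (\<alpha>, \<beta>, \<gamma>, \<delta>) \<Rightarrow>
      has_size_cv {I\<in>P. singleton_iv I} \<alpha> \<and>
      has_size_cv {I\<in>P. compact_iv I} \<beta> \<and>
      has_size_cv {I\<in>P. halfopen_iv I} \<gamma> \<and>
      has_size_cv {I\<in>P. open_iv I} \<delta>)"

definition Q1 :: "(cardval \<times> cardval \<times> cardval \<times> cardval) set" where
  "Q1 = {(Om a, Om b, Om c, Om d) | a b c d.
          a + b + 1 = d \<or> (a + b + 1 > d \<and> c = \<infinity>)}"

definition Q2 :: "(cardval \<times> cardval \<times> cardval \<times> cardval) set" where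
  "Q2 = {(Cont, Om b, Om c, Om d) | b c d. True}"

end

theory Submission
  imports Defs
begin

text \<open>
  Call a member closed if it is a singleton or compact. Walking to the right from the right end
  of an open member, one only meets half-open members containing their left end until a closed
  member occurs; hence two open members are always separated by a closed one, and
  \<open>\<delta> \<le> \<alpha> + \<beta> + 1\<close>. In a countable partition two closed members are separated by a non-closed
  one, since an interval is not a countable union of at least two disjoint nonempty closed sets
  (Sierpinski). So if \<open>\<gamma>\<close> and \<open>\<delta>\<close> are finite, then the partition is finite, and
  additivity of the Euler characteristic with compact support yields \<open>\<delta> = \<alpha> + \<beta> + 1\<close>.
  In an uncountable partition the singletons fill an uncountable closed set up to countably many
  points, so there are continuum many of them.

  Conversely, \<open>(\<alpha>, \<beta>, \<gamma>, \<alpha> + \<beta> + 1)\<close> is realized by an open ray followed by blocks \<open>[n, n + 1)\<close>,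
  each of which is a half-open member, or a closed member followed by an open one. Surplus open
  members can then be cut into infinitely many half-open intervals, or into points.
\<close>

section \<open>Cardinal values\<close>

text \<open>Every infinite set gets the value \<open>\<infinity>\<close>, so \<open>ecard\<close>
  determines the size of countable sets only; countability is carried separately, as in
  \<open>has_size_cv_Om\<close>.\<close>

definition ecard :: "'a set \<Rightarrow> enat" where
  "ecard S = (if finite S then enat (card S) else \<infinity>)"

lemma has_size_cv_Om: "has_size_cv S (Om k) \<longleftrightarrow> countable S \<and> ecard S = k"
  by (cases k) (auto simp: has_size_cv_def ecard_def countable_finite)

lemma ecard_infinite: "infinite S \<Longrightarrow> ecard S = \<infinity>"
  by (simp add: ecard_def)

lemma ecard_eq_infinity_iff: "ecard S = \<infinity> \<longleftrightarrow> infinite S"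
  by (simp add: ecard_def)

lemma ecard_image: "inj_on f S \<Longrightarrow> ecard (f ` S) = ecard S"
  by (simp add: ecard_def card_image finite_image_iff)

lemma ecard_Un_disjoint: "S \<inter> T = {} \<Longrightarrow> ecard (S \<union> T) = ecard S + ecard T"
  by (auto simp: ecard_def card_Un_disjoint)

lemma ecard_insert: "x \<notin> S \<Longrightarrow> ecard (insert x S) = ecard S + 1"
  by (auto simp: ecard_def one_enat_def)

lemma ecard_less: "ecard {n::nat. enat n < k} = k"
proof (cases k)
  case (enat m)
  then have "{n::nat. enat n < k} = {..<m}" by auto
  then show ?thesis by (simp add: ecard_def enat)
qed (simp add: ecard_def)

lemma ecard_subset:
  assumes "d \<le> ecard S"
  obtains T where "T \<subseteq> S" "ecard T = d"
proof (cases d)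
  case (enat n)
  show ?thesis
  proof (cases "finite S")
    case True
    then show ?thesis
      using assms enat that obtain_subset_with_card_n[of n S]
      by (metis ecard_def enat_ord_simps(1))
  next
    case False
    then show ?thesis
      using enat that infinite_arbitrarily_large[of S n]
      by (metis ecard_def)
  qed
next
  case infinity
  then show ?thesis using assms that[of S] by simp
qed

text \<open>The disjoint union of sets of sizes \<open>s k\<close> is countable, hence in bijection
  with an initial segment of the naturals or with all of them; the label of \<open>n\<close> is the
  summand into which \<open>n\<close> is mapped. This arranges blocks of several kinds in one
  sequence, even if more than one kind occurs infinitely often.\<close>

lemma labelling_exists:
  fixes s :: "nat \<Rightarrow> enat"
  obtains N :: enat and t :: "nat \<Rightarrow> nat"
  where "\<And>k. ecard {n. enat n < N \<and> t n = k} = s k"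
proof -
  define X where "X = (SIGMA k:UNIV. {m. enat m < s k})"
  have "\<exists>h. bij_betw h {n. enat n < ecard X} X"
  proof (cases "finite X")
    case True
    have "{n. enat n < ecard X} = {0..<card X}"
      using True by (auto simp: ecard_def)
    then show ?thesis using ex_bij_betw_nat_finite[OF True] by simp
  next
    case False
    then have "{n. enat n < ecard X} = UNIV" by (auto simp: ecard_def)
    moreover have "bij_betw (from_nat_into X) UNIV X"
      using False by (intro bij_betw_from_nat_into) auto
    ultimately show ?thesis by auto
  qed
  then obtain h where h: "bij_betw h {n. enat n < ecard X} X" by blast
  have "ecard {n. enat n < ecard X \<and> fst (h n) = k} = s k" for k
  proof -
    let ?Y = "{n. enat n < ecard X \<and> fst (h n) = k}"
    have inj: "inj_on h ?Y" and im: "h ` {n. enat n < ecard X} = X"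
      using h by (auto simp: bij_betw_def inj_on_def)
    have "h ` ?Y = {p \<in> h ` {n. enat n < ecard X}. fst p = k}" by auto
    also have "\<dots> = Pair k ` {m. enat m < s k}"
      unfolding im by (auto simp: X_def)
    finally have "ecard ?Y = ecard (Pair k ` {m. enat m < s k})"
      using ecard_image[OF inj] by simp
    also have "\<dots> = s k"
      by (subst ecard_image) (auto simp: inj_on_def ecard_less)
    finally show ?thesis .
  qed
  then show ?thesis using that[of "ecard X" "\<lambda>n. fst (h n)"] by blast
qed

section \<open>Interlaced sets of reals\<close>

text \<open>The induction removes the largest point \<open>m\<close> of \<open>B\<close> together
  with a point \<open>a\<close> of \<open>A\<close> between \<open>m\<close> and its predecessor
  \<open>m'\<close>. The other points of \<open>B\<close> are at most \<open>m'\<close>, so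
  \<open>a\<close> separates none of them.\<close>

lemma finite_interlaced_card:
  fixes A B :: "real set"
  assumes "finite A" "finite B"
    and "\<And>b b'. b \<in> B \<Longrightarrow> b' \<in> B \<Longrightarrow> b < b' \<Longrightarrow> \<exists>a\<in>A. b < a \<and> a < b'"
  shows "card B \<le> card A + 1"
  using assms(2,1,3)
proof (induction arbitrary: A rule: finite_linorder_max_induct)
  case (insert m B)
  show ?case
  proof (cases "B = {}")
    case False
    define m' where "m' = Max B"
    have m': "m' \<in> B" "\<And>b. b \<in> B \<Longrightarrow> b \<le> m'"
      using False insert.hyps by (auto simp: m'_def)
    obtain a where a: "a \<in> A" "m' < a" "a < m"
      using insert.prems(2)[of m' m] m' insert.hyps by auto
    have "card B \<le> card (A - {a}) + 1"
    proof (rule insert.IH)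
      fix b b' assume "b \<in> B" "b' \<in> B" "b < b'"
      then obtain x where "x \<in> A" "b < x" "x < b'"
        using insert.prems(2)[of b b'] by auto
      moreover from this have "x \<noteq> a"
        using m'(2)[OF \<open>b' \<in> B\<close>] a by auto
      ultimately show "\<exists>x\<in>A - {a}. b < x \<and> x < b'" by auto
    qed (use insert.prems in auto)
    moreover have "card (A - {a}) + 1 = card A"
      using a insert.prems by (metis Suc_eq_plus1 card.remove)
    ultimately show ?thesis using insert.hyps by auto
  qed simp
qed simp

text \<open>If \<open>A\<close> is finite, the finite bound rules out a subset of \<open>B\<close>
  with \<open>card A + 2\<close> elements, so \<open>B\<close> is finite as well.\<close>

lemma ecard_interlaced:
  fixes A B :: "real set"
  assumes "\<And>b b'. b \<in> B \<Longrightarrow> b' \<in> B \<Longrightarrow> b < b' \<Longrightarrow> \<exists>a\<in>A. b < a \<and> a < b'"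
  shows "ecard B \<le> ecard A + 1"
proof (cases "finite A")
  case A: True
  have bound: "card B' \<le> card A + 1" if "B' \<subseteq> B" "finite B'" for B'
    using finite_interlaced_card[of A B'] that assms A by blast
  have "finite B"
  proof (rule ccontr)
    assume "infinite B"
    then obtain B' where "B' \<subseteq> B" "finite B'" "card B' = card A + 2"
      using infinite_arbitrarily_large by blast
    then show False using bound[of B'] by simp
  qed
  then show ?thesis
    using bound[of B] A by (simp add: ecard_def one_enat_def)
qed (simp add: ecard_def)

section \<open>Kinds of intervals\<close>

definition closed_iv :: "real set \<Rightarrow> bool" where
  "closed_iv I \<longleftrightarrow> singleton_iv I \<or> compact_iv I"

lemma interval_kinds:
  assumes "is_interval I" "I \<noteq> {}"
  shows "closed_iv I \<or> halfopen_iv I \<or> open_iv I"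
proof -
  obtain a b where "I = {} \<or> I = UNIV \<or> I = {..<b} \<or> I = {..b} \<or> I = {a<..} \<or> I = {a..} \<or>
      I = {a<..<b} \<or> I = {a<..b} \<or> I = {a..<b} \<or> I = {a..b}"
    using is_real_interval[OF assms(1)] by blast
  \<comment> \<open>The ten shapes carry no order condition on \<open>a\<close> and
    \<open>b\<close>. Nonemptiness excludes the degenerate ones, except that \<open>{a..b}\<close>
    with \<open>a = b\<close> is a singleton.\<close>
  then have "(I = UNIV \<or> I = {..<b} \<or> I = {a<..} \<or> I = {a<..<b} \<and> a < b) \<or>
      (I = {..b} \<or> I = {a..} \<or> (I = {a<..b} \<or> I = {a..<b}) \<and> a < b) \<or>
      I = {a..b} \<and> a < b \<or> I = {a..b} \<and> a = b"
    using assms(2) by (elim disjE; cases a b rule: linorder_cases; simp)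
  then consider "I = UNIV \<or> I = {..<b} \<or> I = {a<..} \<or> I = {a<..<b} \<and> a < b"
    | "I = {..b} \<or> I = {a..} \<or> (I = {a<..b} \<or> I = {a..<b}) \<and> a < b"
    | "I = {a..b} \<and> a < b" | "I = {a..b} \<and> a = b"
    by argo
  then show ?thesis
  proof cases
    case 1
    then show ?thesis unfolding open_iv_def by blast
  next
    case 2
    then show ?thesis unfolding halfopen_iv_def by blast
  next
    case 3
    then show ?thesis unfolding closed_iv_def compact_iv_def by blast
  next
    case 4
    then show ?thesis unfolding closed_iv_def singleton_iv_def by auto
  qed
qed

lemma singleton_iv_topological: "singleton_iv I \<Longrightarrow> compact I \<and> \<not> open I \<and> countable I"
  using not_open_singleton by (auto simp: singleton_iv_def)

lemma compact_iv_topological: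
  assumes "compact_iv I"
  shows "compact I \<and> \<not> open I \<and> uncountable I"
proof -
  obtain a b where ab: "a < b" "I = {a..b}" using assms by (auto simp: compact_iv_def)
  moreover have "\<not> open I"
  proof
    assume "open I"
    then have "I = {}" using compact_open[of I] ab by simp
    then show False using ab by simp
  qed
  ultimately show ?thesis by (simp add: uncountable_closed_interval)
qed

lemma uncountable_interval_superset:
  fixes a b :: real
  assumes "a < b" "{a<..<b} \<subseteq> S"
  shows "uncountable S"
  using assms uncountable_open_interval[of a b] countable_subset by blast

lemma open_iv_topological:
  assumes "open_iv I"
  shows "\<not> compact I" "open I" "uncountable I"
proof -
  show "open I" using assms by (auto simp: open_iv_def)
  from assms consider a b where "a < b" "I = {a<..<b}" | t where "I = {t<..}"
    | t where "I = {..<t}" | "I = UNIV"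
    unfolding open_iv_def by blast
  then have "\<exists>a b. a < b \<and> {a<..<b} \<subseteq> I"
  proof cases
    case (2 t)
    then show ?thesis by (intro exI[of _ t] exI[of _ "t + 1"]) auto
  next
    case (3 t)
    then show ?thesis by (intro exI[of _ "t - 1"] exI[of _ t]) auto
  qed (auto intro: exI[of _ 0] exI[of _ 1])
  then show "uncountable I" using uncountable_interval_superset by blast
  then have "I \<noteq> {}" by auto
  then show "\<not> compact I" using \<open>open I\<close> compact_open[of I] by blast
qed

text \<open>The four shapes collapse to two mirror-image cases, so that later arguments need not
  distinguish bounded from unbounded intervals.\<close>

lemma halfopen_iv_interval_cases:
  assumes "halfopen_iv I"
  obtains (left) s where "s \<in> I" "I \<subseteq> {s..}" "\<And>x. x \<in> I \<Longrightarrow> \<exists>y\<in>I. x < y"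
  | (right) s where "s \<in> I" "I \<subseteq> {..s}" "\<And>x. x \<in> I \<Longrightarrow> \<exists>y\<in>I. y < x"
proof -
  from assms consider u v where "u < v" "I = {u..<v}" | u v where "u < v" "I = {u<..v}"
    | t where "I = {t..}" | t where "I = {..t}"
    unfolding halfopen_iv_def by blast
  then show ?thesis
  proof cases
    case (1 u v)
    show ?thesis
    proof (rule left[of u])
      show "\<exists>y\<in>I. x < y" if "x \<in> I" for x
        by (intro bexI[of _ "(x + v) / 2"]) (use 1 that in \<open>auto simp: field_simps\<close>)
    qed (use 1 in auto)
  next
    case (2 u v)
    show ?thesis
    proof (rule right[of v])
      show "\<exists>y\<in>I. y < x" if "x \<in> I" for x
        by (intro bexI[of _ "(u + x) / 2"]) (use 2 that in \<open>auto simp: field_simps\<close>)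
    qed (use 2 in auto)
  next
    case (3 t)
    show ?thesis
    proof (rule left[of t])
      show "\<exists>y\<in>I. x < y" if "x \<in> I" for x
        by (intro bexI[of _ "x + 1"]) (use 3 that in auto)
    qed (use 3 in auto)
  next
    case (4 t)
    show ?thesis
    proof (rule right[of t])
      show "\<exists>y\<in>I. y < x" if "x \<in> I" for x
        by (intro bexI[of _ "x - 1"]) (use 4 that in auto)
    qed (use 4 in auto)
  qed
qed

lemma open_real_no_min:
  assumes "open (S::real set)" "s \<in> S"
  shows "\<exists>x\<in>S. x < s"
proof -
  obtain e where "e > 0" "ball s e \<subseteq> S" using assms openE by blast
  moreover have "s - e/2 \<in> ball s e" using \<open>e > 0\<close> by (simp add: dist_real_def)
  ultimately show ?thesis by (intro bexI[of _ "s - e/2"]) auto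
qed

lemma open_real_no_max:
  assumes "open (S::real set)" "s \<in> S"
  shows "\<exists>x\<in>S. s < x"
proof -
  obtain e where "e > 0" "ball s e \<subseteq> S" using assms openE by blast
  moreover have "s + e/2 \<in> ball s e" using \<open>e > 0\<close> by (simp add: dist_real_def)
  ultimately show ?thesis by (intro bexI[of _ "s + e/2"]) auto
qed

lemma halfopen_iv_topological:
  assumes "halfopen_iv I"
  shows "\<not> compact I" "\<not> open I" "uncountable I"
proof -
  show "\<not> compact I"
  proof
    assume "compact I"
    moreover have "I \<noteq> {}" using assms by (cases rule: halfopen_iv_interval_cases) auto
    ultimately obtain m M where "m \<in> I" "M \<in> I" "\<forall>x\<in>I. m \<le> x \<and> x \<le> M"
      using compact_attains_inf[of I] compact_attains_sup[of I] by blast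
    from assms show False
      proof (cases rule: halfopen_iv_interval_cases)
      case left
      show ?thesis using left(3)[OF \<open>M \<in> I\<close>] \<open>\<forall>x\<in>I. m \<le> x \<and> x \<le> M\<close> by auto
    next
      case right
      show ?thesis using right(3)[OF \<open>m \<in> I\<close>] \<open>\<forall>x\<in>I. m \<le> x \<and> x \<le> M\<close> by auto
    qed
  qed
  show "\<not> open I"
  proof
    assume "open I"
    from assms show False
    proof (cases rule: halfopen_iv_interval_cases)
      case (left s)
      then show ?thesis using open_real_no_min[OF \<open>open I\<close>, of s] by force
    next
      case (right s)
      then show ?thesis using open_real_no_max[OF \<open>open I\<close>, of s] by force
    qed
  qed
  from assms consider u v where "u < v" "I = {u..<v}" | u v where "u < v" "I = {u<..v}"
    | t where "I = {t..}" | t where "I = {..t}"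
    unfolding halfopen_iv_def by blast
  then have "\<exists>a b. a < b \<and> {a<..<b} \<subseteq> I"
  proof cases
    case (1 u v)
    then show ?thesis by (intro exI[of _ u] exI[of _ v]) auto
  next
    case (2 u v)
    then show ?thesis by (intro exI[of _ u] exI[of _ v]) auto
  next
    case (3 t)
    then show ?thesis by (intro exI[of _ t] exI[of _ "t + 1"]) auto
  next
    case (4 t)
    then show ?thesis by (intro exI[of _ "t - 1"] exI[of _ t]) auto
  qed
  then show "uncountable I" using uncountable_interval_superset by blast
qed

lemma closed_iv_topological:
  assumes "closed_iv I"
  shows "compact I" "\<not> open I"
  using assms singleton_iv_topological compact_iv_topological by (auto simp: closed_iv_def)

text \<open>Compactness and openness tell the main kinds apart: closed members are compact and not
  open, open ones are open and not compact, half-open ones are neither. Countability tells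
  singletons from compact intervals of positive length.\<close>

lemma kinds_exclusive:
  "singleton_iv I \<Longrightarrow> \<not> compact_iv I"
  "closed_iv I \<Longrightarrow> \<not> halfopen_iv I"
  "closed_iv I \<Longrightarrow> \<not> open_iv I"
  "halfopen_iv I \<Longrightarrow> \<not> open_iv I"
  using singleton_iv_topological[of I] compact_iv_topological[of I] halfopen_iv_topological[of I]
    open_iv_topological[of I] closed_iv_topological[of I] by argo+

lemma closed_iv_interval:
  assumes "closed_iv I"
  obtains a b where "a \<le> b" "I = {a..b}"
proof -
  from assms consider a where "I = {a..a}" | a b where "a < b" "I = {a..b}"
    unfolding closed_iv_def singleton_iv_def compact_iv_def by auto
  then show ?thesis using that by cases (blast intro: less_imp_le)+
qed

section \<open>Members of an interval partition\<close>

lemma partition_member: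
  assumes "interval_partition P"
  obtains I where "I \<in> P" "x \<in> I"
proof -
  have "x \<in> \<Union>P" using assms by (simp add: interval_partition_def)
  then show ?thesis using that by blast
qed

lemma partition_unique:
  assumes "interval_partition P" "I \<in> P" "J \<in> P" "x \<in> I" "x \<in> J"
  shows "I = J"
  using assms unfolding interval_partition_def by blast

lemma partition_convex:
  assumes "interval_partition P" "I \<in> P" "x \<in> I" "z \<in> I" "x \<le> y" "y \<le> z"
  shows "y \<in> I"
  using assms unfolding interval_partition_def by (meson mem_is_interval_1_I)

lemma partition_kinds:
  assumes "interval_partition P" "I \<in> P"
  shows "closed_iv I \<or> halfopen_iv I \<or> open_iv I"
  using assms interval_kinds unfolding interval_partition_def by blast

lemma partition_nonempty:
  assumes "interval_partition P" "I \<in> P"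
  shows "I \<noteq> {}"
  using assms unfolding interval_partition_def by blast

text \<open>If \<open>y' \<le> x'\<close> held, then convexity would put \<open>x\<close> into
  \<open>J\<close> or \<open>y'\<close> into \<open>I\<close>, according to the order of
  \<open>x\<close> and \<open>y'\<close>.\<close>

lemma partition_less:
  assumes P: "interval_partition P" and "I \<in> P" "J \<in> P" "I \<noteq> J"
    and "x \<in> I" "y \<in> J" "x < y" "x' \<in> I" "y' \<in> J"
  shows "x' < y'"
proof (rule ccontr)
  assume "\<not> x' < y'"
  then have "y' \<le> x'" by simp
  have "x \<in> J \<or> y' \<in> I"
    using partition_convex[OF P \<open>J \<in> P\<close> \<open>y' \<in> J\<close> \<open>y \<in> J\<close>, of x]
      partition_convex[OF P \<open>I \<in> P\<close> \<open>x \<in> I\<close> \<open>x' \<in> I\<close>, of y'] \<open>x < y\<close> \<open>y' \<le> x'\<close>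
    by linarith
  then show False using assms partition_unique[OF P] by blast
qed

text \<open>A representative point in each member reduces the claim to
  \<open>ecard_interlaced\<close>; disjointness makes the choice injective. It is applied to open
  members separated by closed ones, and to closed members separated by non-closed ones.\<close>

lemma members_interlaced:
  assumes P: "interval_partition P" and sub: "\<X> \<subseteq> P" "\<Y> \<subseteq> P"
    and between: "\<And>I J x y. I \<in> \<X> \<Longrightarrow> J \<in> \<X> \<Longrightarrow> I \<noteq> J \<Longrightarrow> x \<in> I \<Longrightarrow> y \<in> J \<Longrightarrow> x < y \<Longrightarrow>
      \<exists>K\<in>\<Y>. K \<subseteq> {x<..<y}"
  shows "ecard \<X> \<le> ecard \<Y> + 1"
proof -
  define r :: "real set \<Rightarrow> real" where "r I = (SOME x. x \<in> I)" for I
  have r: "r I \<in> I" if "I \<in> P" for I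
    using partition_nonempty[OF P that] unfolding r_def by (simp add: some_in_eq)
  have inj: "inj_on r P"
    by (metis inj_onI r partition_unique[OF P])
  have "ecard (r ` \<X>) \<le> ecard (r ` \<Y>) + 1"
  proof (rule ecard_interlaced)
    fix b b' assume "b \<in> r ` \<X>" "b' \<in> r ` \<X>" "b < b'"
    then obtain I J where IJ: "I \<in> \<X>" "J \<in> \<X>" "b = r I" "b' = r J" "I \<noteq> J" by auto
    then obtain K where "K \<in> \<Y>" "K \<subseteq> {b<..<b'}"
      using between[OF IJ(1,2,5), of b b'] r sub \<open>b < b'\<close> by blast
    then have "r K \<in> {b<..<b'}" using r[of K] sub by blast
    then show "\<exists>a\<in>r ` \<Y>. b < a \<and> a < b'"
      using \<open>K \<in> \<Y>\<close> by auto
  qed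
  then show ?thesis
    using ecard_image inj_on_subset[OF inj] sub by metis
qed

section \<open>Separation of open members and of closed members\<close>

text \<open>Without a closed member in between, let \<open>s\<close> be the supremum of the points
  reached from \<open>Sup U\<close> while passing only through members with a least element. Then
  \<open>s\<close> lies in such a member and could be moved further to the right. It does not reach
  \<open>y\<close>, since the open \<open>W\<close> has no least element.\<close>

lemma closed_between_opens:
  assumes P: "interval_partition P" and U: "U \<in> P" "open_iv U" and W: "W \<in> P" "open_iv W"
    and ne: "U \<noteq> W" and x: "x \<in> U" and y: "y \<in> W" and "x < y"
  shows "\<exists>K\<in>P. closed_iv K \<and> K \<subseteq> {x<..<y}"
proof (rule ccontr)
  assume none: "\<not> ?thesis"
  define f where "f z = (THE I. I \<in> P \<and> z \<in> I)" for z :: real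
  have f: "f z \<in> P" "z \<in> f z" for z
  proof -
    obtain I where I: "I \<in> P" "z \<in> I" using partition_member[OF P] .
    have "f z = I" unfolding f_def
      by (rule the_equality) (use I partition_unique[OF P] in blast)+
    with I show "f z \<in> P" "z \<in> f z" by auto
  qed
  have f_eq: "f z = I" if "I \<in> P" "z \<in> I" for z I
    using partition_unique[OF P] f that by blast
  \<comment> \<open>Short for left closed; an interval that is unbounded below is not
    \<open>lc\<close>.\<close>
  define lc where "lc I \<longleftrightarrow> (\<exists>m\<in>I. \<forall>i\<in>I. m \<le> i)" for I :: "real set"
  have U_less: "u < y" if "u \<in> U" for u
    using partition_less[OF P U(1) W(1) ne x y \<open>x < y\<close> that y] .
  have open_nlc: "\<not> lc I" if "open_iv I" for I
    using open_real_no_min[OF open_iv_topological(2)[OF that]] unfolding lc_def by force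
  define a where "a = Sup U"
  have bdd: "bdd_above U" using U_less by (meson bdd_above.I less_imp_le)
  have a_upper: "u \<le> a" if "u \<in> U" for u
    unfolding a_def using that bdd by (rule cSup_upper)
  have "a \<notin> U"
    using open_real_no_max[OF open_iv_topological(2)[OF U(2)]] a_upper by force
  then have "x < a" using a_upper[OF x] x by (cases "x = a") auto
  \<comment> \<open>A point of \<open>I\<close> below \<open>a\<close> would have a point of
    \<open>U\<close> above it, and convexity would put that point into \<open>I\<close>.\<close>
  have above_a: "a \<le> i" if "I \<in> P" "I \<noteq> U" "z \<in> I" "a \<le> z" "i \<in> I" for I z i
  proof (rule ccontr)
    assume "\<not> a \<le> i"
    then obtain u where "u \<in> U" "i < u"
      unfolding a_def using less_cSup_iff[of U i] x bdd by auto
    then have "u \<in> I" using partition_convex[OF P, of I i z u] that a_upper[of u] by auto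
    then show False using partition_unique[OF P] \<open>u \<in> U\<close> U(1) that by blast
  qed
  have fU: "f z \<noteq> U" if "a \<le> z" for z
    using a_upper[of z] \<open>a \<notin> U\<close> f(2)[of z] that by (cases "z = a") auto
  define L where "L = {z. a \<le> z \<and> z \<le> y \<and> (\<forall>t\<in>{a..z}. lc (f t))}"
  have "a \<le> y" unfolding a_def using x U_less by (intro cSup_least) (auto intro: less_imp_le)
  \<comment> \<open>By \<open>above_a\<close> the point \<open>a\<close> is the least element of its
    own member.\<close>
  have lc_a: "lc (f a)"
    unfolding lc_def using above_a[OF f(1) fU f(2)] f(2) by blast
  then have "a \<in> L" using \<open>a \<le> y\<close> by (auto simp: L_def)
  define s where "s = Sup L"
  have bddL: "bdd_above L" by (rule bdd_aboveI[of _ y]) (simp add: L_def)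
  have s: "a \<le> s" "s \<le> y"
  proof -
    show "a \<le> s" unfolding s_def using \<open>a \<in> L\<close> bddL by (rule cSup_upper)
    show "s \<le> y" unfolding s_def
    proof (rule cSup_least)
      show "L \<noteq> {}" using \<open>a \<in> L\<close> by blast
    qed (simp add: L_def)
  qed
  have lc_below: "lc (f t)" if "a \<le> t" "t < s" for t
  proof -
    obtain z where "z \<in> L" "t < z"
      using \<open>t < s\<close> less_cSup_iff[of L t] bddL \<open>a \<in> L\<close> unfolding s_def by auto
    then show ?thesis using that by (auto simp: L_def)
  qed
  \<comment> \<open>If \<open>f s\<close> had no least element, it would contain some
    \<open>i < s\<close>. Then \<open>a \<le> i\<close> by \<open>above_a\<close>, so
    \<open>lc_below\<close> would apply to \<open>f i = f s\<close>.\<close>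
  have lc_s: "lc (f s)"
  proof (rule ccontr)
    assume "\<not> lc (f s)"
    then obtain i where i: "i \<in> f s" "i < s" using f(2)[of s] unfolding lc_def by force
    then have "f i = f s" using f_eq f by blast
    then show False
      using lc_below[of i] i above_a[OF f(1) fU f(2), of s i] s \<open>\<not> lc (f s)\<close> by auto
  qed
  have "s \<noteq> y" using lc_s open_nlc[OF W(2)] f_eq[OF W(1) y] by auto
  then have "s < y" using s by simp
  \<comment> \<open>Otherwise \<open>s\<close> is the largest element of \<open>f s\<close>, which
    also has a least one. So \<open>f s\<close> is a closed member, and it lies strictly between
    \<open>x\<close> and \<open>y\<close>.\<close>
  have "\<exists>i\<in>f s. s < i"
  proof (rule ccontr)
    assume *: "\<not> ?thesis"
    then have "\<not> open_iv (f s)" using lc_s open_nlc by blast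
    moreover have "\<not> halfopen_iv (f s)"
    proof
      assume "halfopen_iv (f s)"
      then show False
      proof (cases rule: halfopen_iv_interval_cases)
        case left
        then show ?thesis using * f(2)[of s] by blast
      next
        case right
        then show ?thesis using lc_s unfolding lc_def by force
      qed
    qed
    ultimately have "closed_iv (f s)" using partition_kinds[OF P f(1)] by blast
    moreover have "f s \<subseteq> {x<..<y}"
      using above_a[OF f(1) fU f(2), of s] s \<open>x < a\<close> * \<open>s < y\<close> by force
    ultimately show False using none f(1) by blast
  qed
  then obtain i where i: "i \<in> f s" "s < i" by blast
  \<comment> \<open>Truncation at \<open>y\<close> keeps \<open>j\<close> in the range allowed in
    \<open>L\<close>, while \<open>j\<close> still exceeds \<open>s\<close>.\<close>
  define j where "j = min i y"
  have "j \<in> L"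
  proof -
    have "lc (f t)" if "a \<le> t" "t \<le> j" for t
    proof (cases "t < s")
      case False
      then have "t \<in> f s"
        using partition_convex[OF P f(1) f(2) i(1), of t] that by (auto simp: j_def)
      then show ?thesis using f_eq[OF f(1)] lc_s by metis
    qed (use lc_below that in auto)
    then show ?thesis using s i \<open>s < y\<close> by (auto simp: L_def j_def)
  qed
  then have "j \<le> s" unfolding s_def using bddL by (rule cSup_upper)
  then show False using i \<open>s < y\<close> by (auto simp: j_def)
qed

text \<open>If all members in between were closed, the traces of the members on
  \<open>[x, y]\<close> would be countably many disjoint nonempty closed sets covering it. By
  Sierpinski's theorem there is only one trace, so \<open>I\<close> would contain
  \<open>y\<close>.\<close>

lemma nonclosed_between_closeds:
  assumes P: "interval_partition P" and "countable P"
    and I: "I \<in> P" "closed_iv I" and J: "J \<in> P" "closed_iv J"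
    and ne: "I \<noteq> J" and x: "x \<in> I" and y: "y \<in> J" and "x < y"
  shows "\<exists>K\<in>P. \<not> closed_iv K \<and> K \<subseteq> {x<..<y}"
proof (rule ccontr)
  assume none: "\<not> ?thesis"
  \<comment> \<open>A member other than \<open>I\<close> and \<open>J\<close> that meets
    \<open>[x, y]\<close> lies strictly between \<open>x\<close> and \<open>y\<close>, so
    \<open>none\<close> makes it closed.\<close>
  have closed: "closed_iv K" if K: "K \<in> P" "k \<in> K" "x \<le> k" "k \<le> y" for K k
  proof (cases "K = I \<or> K = J")
    case False
    have "k \<noteq> x" "k \<noteq> y" using False K I(1) J(1) x y partition_unique[OF P] by blast+
    then have "x < k" "k < y" using K by auto
    have "K \<subseteq> {x<..<y}"
      using partition_less[OF P I(1) K(1) _ x K(2) \<open>x < k\<close> x]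
        partition_less[OF P K(1) J(1) _ K(2) y \<open>k < y\<close> _ y] False
      unfolding greaterThanLessThan_iff subset_iff by metis
    then show ?thesis using none K by blast
  qed (use I J in auto)
  define \<U> where "\<U> = {K \<inter> {x..y} | K. K \<in> P \<and> K \<inter> {x..y} \<noteq> {}}"
  have "\<U> = {{x..y}}"
  proof (rule real_Sierpinski_lemma)
    have "\<U> \<subseteq> (\<lambda>K. K \<inter> {x..y}) ` P" by (auto simp: \<U>_def)
    then show "countable \<U>" by (rule countable_subset) (use \<open>countable P\<close> in simp)
    show "pairwise disjnt \<U>"
      unfolding pairwise_def disjnt_def \<U>_def using partition_unique[OF P] by blast
    show "closed C \<and> C \<noteq> {}" if "C \<in> \<U>" for C
    proof -
      have "\<exists>K. C = K \<inter> {x..y} \<and> K \<in> P \<and> K \<inter> {x..y} \<noteq> {}"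
        using that unfolding \<U>_def by (rule CollectD)
      then obtain K where K: "C = K \<inter> {x..y}" "K \<in> P" "K \<inter> {x..y} \<noteq> {}" by blast
      obtain k where k: "k \<in> K" "x \<le> k" "k \<le> y" using K(3) by auto
      then have "closed K"
        using closed[OF K(2) k] closed_iv_topological(1) compact_imp_closed by blast
      then show ?thesis using K by auto
    qed
    show "\<Union>\<U> = {x..y}"
    proof
      show "{x..y} \<subseteq> \<Union>\<U>"
      proof
        fix z assume "z \<in> {x..y}"
        moreover obtain K where "K \<in> P" "z \<in> K" using partition_member[OF P] .
        ultimately show "z \<in> \<Union>\<U>" unfolding \<U>_def by blast
      qed
    qed (auto simp: \<U>_def)
  qed (use \<open>x < y\<close> in simp)
  moreover have "I \<inter> {x..y} \<in> \<U>"
  proof -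
    have "x \<in> I \<inter> {x..y}" using x \<open>x < y\<close> by simp
    then show ?thesis unfolding \<U>_def using I(1) by blast
  qed
  ultimately have "I \<inter> {x..y} = {x..y}" by simp
  moreover have "y \<in> {x..y}" using \<open>x < y\<close> by simp
  ultimately have "y \<in> I" by blast
  then show False using partition_unique[OF P I(1) J(1) _ y] ne by simp
qed

section \<open>Finite partitions\<close>

text \<open>Integers are used because \<open>ends I - 1\<close> is negative for open
  intervals.\<close>

definition ends :: "real set \<Rightarrow> int" where
  "ends I = of_bool (\<exists>m\<in>I. \<forall>x\<in>I. m \<le> x) + of_bool (\<exists>m\<in>I. \<forall>x\<in>I. x \<le> m)"

lemma ends_closed_iv: "closed_iv I \<Longrightarrow> ends I = 2"
  by (erule closed_iv_interval) (auto simp: ends_def)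

lemma ends_halfopen_iv: "halfopen_iv I \<Longrightarrow> ends I = 1"
proof (erule halfopen_iv_interval_cases)
  fix s assume s: "s \<in> I" "I \<subseteq> {s..}" and "\<And>x. x \<in> I \<Longrightarrow> \<exists>y\<in>I. x < y"
  then have "\<not> (\<exists>m\<in>I. \<forall>x\<in>I. x \<le> m)" by force
  moreover have "\<exists>m\<in>I. \<forall>x\<in>I. m \<le> x" using s by auto
  ultimately show "ends I = 1" by (simp add: ends_def)
next
  fix s assume s: "s \<in> I" "I \<subseteq> {..s}" and "\<And>x. x \<in> I \<Longrightarrow> \<exists>y\<in>I. y < x"
  then have "\<not> (\<exists>m\<in>I. \<forall>x\<in>I. m \<le> x)" by force
  moreover have "\<exists>m\<in>I. \<forall>x\<in>I. x \<le> m" using s by auto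
  ultimately show "ends I = 1" by (simp add: ends_def)
qed

lemma ends_open:
  assumes "open I"
  shows "ends I = 0"
proof -
  from assms have "\<not> (\<exists>m\<in>I. \<forall>x\<in>I. m \<le> x)" "\<not> (\<exists>m\<in>I. \<forall>x\<in>I. x \<le> m)"
    using open_real_no_min[of I] open_real_no_max[of I] by (meson not_le)+
  then show ?thesis by (simp add: ends_def)
qed

text \<open>The union takes its left end from \<open>A\<close> and its right end from
  \<open>B\<close>. The cut \<open>Sup A\<close> belongs to the interval
  \<open>A \<union> B\<close>, so it is the maximum of \<open>A\<close> or the minimum of
  \<open>B\<close>, and exactly one of these exists; this accounts for the -1.\<close>

lemma ends_Un:
  assumes A: "A \<noteq> {}" and B: "B \<noteq> {}" and S: "is_interval (A \<union> B)"
    and less: "\<And>a b. a \<in> A \<Longrightarrow> b \<in> B \<Longrightarrow> a < b"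
  shows "ends (A \<union> B) = ends A + ends B - 1"
proof -
  obtain a0 b0 where ab0: "a0 \<in> A" "b0 \<in> B" using A B by blast
  have min: "(\<exists>m\<in>A \<union> B. \<forall>x\<in>A \<union> B. m \<le> x) \<longleftrightarrow> (\<exists>m\<in>A. \<forall>x\<in>A. m \<le> x)"
  proof
    assume "\<exists>m\<in>A \<union> B. \<forall>x\<in>A \<union> B. m \<le> x"
    then obtain m where m: "m \<in> A \<union> B" "\<forall>x\<in>A \<union> B. m \<le> x" by blast
    then have "m \<in> A" using less[of a0 m] ab0 by force
    then show "\<exists>m\<in>A. \<forall>x\<in>A. m \<le> x" using m by blast
  qed (use less in \<open>force intro: less_imp_le\<close>)
  have max: "(\<exists>m\<in>A \<union> B. \<forall>x\<in>A \<union> B. x \<le> m) \<longleftrightarrow> (\<exists>m\<in>B. \<forall>x\<in>B. x \<le> m)"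
  proof
    assume "\<exists>m\<in>A \<union> B. \<forall>x\<in>A \<union> B. x \<le> m"
    then obtain m where m: "m \<in> A \<union> B" "\<forall>x\<in>A \<union> B. x \<le> m" by blast
    then have "m \<in> B" using less[of m b0] ab0 by force
    then show "\<exists>m\<in>B. \<forall>x\<in>B. x \<le> m" using m by blast
  qed (use less in \<open>force intro: less_imp_le\<close>)
  define s where "s = Sup A"
  have bdd: "bdd_above A" using less[OF _ ab0(2)] by (meson bdd_above.I less_imp_le)
  have s: "a \<le> s" "s \<le> b" if "a \<in> A" "b \<in> B" for a b
  proof -
    show "a \<le> s" unfolding s_def using that bdd by (intro cSup_upper)
    show "s \<le> b" unfolding s_def using A less that(2) by (intro cSup_least) (auto intro: less_imp_le)
  qed
  have "s \<in> A \<union> B"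
    using mem_is_interval_1_I[OF S, of a0 b0 s] s[OF ab0] ab0 by blast
  have "(\<exists>m\<in>A. \<forall>x\<in>A. x \<le> m) \<longleftrightarrow> \<not> (\<exists>m\<in>B. \<forall>x\<in>B. m \<le> x)"
  proof (cases "s \<in> A")
    case True
    \<comment> \<open>The midpoint of \<open>s\<close> and \<open>m\<close> lies in the union and
      above \<open>A\<close>, hence in \<open>B\<close>.\<close>
    have "\<exists>x\<in>B. x < m" if "m \<in> B" for m
    proof -
      have "s < m" using less[OF True that] .
      then have "(s + m) / 2 \<in> A \<union> B"
        using mem_is_interval_1_I[OF S, of s m "(s + m) / 2"] True that by auto
      moreover have "(s + m) / 2 \<notin> A" using s(1)[of "(s + m) / 2" b0] ab0 \<open>s < m\<close> by auto
      ultimately show ?thesis using \<open>s < m\<close> by (intro bexI[of _ "(s + m) / 2"]) auto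
    qed
    then show ?thesis using True s(1)[OF _ ab0(2)] by force
  next
    case False
    then have "s \<in> B" using \<open>s \<in> A \<union> B\<close> by blast
    have "\<not> (\<exists>m\<in>A. \<forall>x\<in>A. x \<le> m)"
    proof
      assume "\<exists>m\<in>A. \<forall>x\<in>A. x \<le> m"
      then obtain m where "m \<in> A" "\<forall>x\<in>A. x \<le> m" by blast
      then have "s = m" unfolding s_def by (intro cSup_eq_maximum) auto
      then show False using \<open>m \<in> A\<close> False by simp
    qed
    then show ?thesis using \<open>s \<in> B\<close> s(2)[OF ab0(1)] by blast
  qed
  then show ?thesis unfolding ends_def min max by auto
qed

text \<open>The Euler characteristic with compact support, \<open>ends I - 1\<close>, is additive.\<close>

lemma ends_Union:
  assumes "finite P" "P \<noteq> {}"
    and "\<And>I. I \<in> P \<Longrightarrow> I \<noteq> {} \<and> is_interval I"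
    and "\<And>I J. I \<in> P \<Longrightarrow> J \<in> P \<Longrightarrow> I \<noteq> J \<Longrightarrow> I \<inter> J = {}"
    and "is_interval (\<Union>P)"
  shows "(\<Sum>I\<in>P. ends I - 1) = ends (\<Union>P) - 1"
  using assms
proof (induction P rule: finite_psubset_induct)
  case (psubset P)
  define r :: "real set \<Rightarrow> real" where "r I = (SOME x. x \<in> I)" for I
  have r: "r I \<in> I" if "I \<in> P" for I
    using psubset.prems(2)[OF that] unfolding r_def by (simp add: some_in_eq)
  \<comment> \<open>The induction removes the leftmost member, found by comparing representatives.
    The rest lies to its right and is again an interval, so \<open>ends_Un\<close> applies.\<close>
  obtain I where I: "I \<in> P" "\<And>J. J \<in> P \<Longrightarrow> r I \<le> r J"
    using psubset.hyps psubset.prems(1) ex_min_if_finite[of "r ` P"]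
    by (metis (no_types, lifting) arg_min_least arg_min_if_finite(1))
  show ?case
  proof (cases "P = {I}")
    case False
    define S where "S = \<Union>(P - {I})"
    have less: "x < y" if "x \<in> I" "y \<in> S" for x y
    proof (rule ccontr)
      assume "\<not> x < y"
      obtain J where J: "J \<in> P" "J \<noteq> I" "y \<in> J" using \<open>y \<in> S\<close> unfolding S_def by blast
      have iv: "is_interval I" "is_interval J" using psubset.prems(2) I J by auto
      have "y \<in> I \<or> r I \<in> J"
        using mem_is_interval_1_I[OF iv(1) r[OF I(1)] that(1), of y]
          mem_is_interval_1_I[OF iv(2) J(3) r[OF J(1)], of "r I"] I(2)[OF J(1)] \<open>\<not> x < y\<close>
        by linarith
      then show False using psubset.prems(3)[OF I(1) J(1)] J r[OF I(1)] by blast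
    qed
    have un: "\<Union>P = I \<union> S" using I by (auto simp: S_def)
    have S: "is_interval S"
      unfolding is_interval_1
    proof (intro ballI allI impI)
      fix a b c assume abc: "a \<in> S" "b \<in> S" "a \<le> c \<and> c \<le> b"
      then have "c \<in> I \<union> S"
        using mem_is_interval_1_I[OF psubset.prems(4), of a b c] un by auto
      then show "c \<in> S" using less[of c a] abc by force
    qed
    have "(\<Sum>J\<in>P. ends J - 1) = (ends I - 1) + (\<Sum>J\<in>P - {I}. ends J - 1)"
      using psubset.hyps I by (simp add: sum.remove)
    also have "(\<Sum>J\<in>P - {I}. ends J - 1) = ends S - 1"
      unfolding S_def
    proof (rule psubset.IH)
      show "P - {I} \<noteq> {}" using False I by blast
    qed (use I psubset.prems S in \<open>auto simp: S_def\<close>)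
    also have "(ends I - 1) + (ends S - 1) = ends (\<Union>P) - 1"
    proof -
      have "S \<noteq> {}" using False I(1) psubset.prems(2) unfolding S_def by blast
      then have "ends (I \<union> S) = ends I + ends S - 1"
        using psubset.prems(2)[OF I(1)] psubset.prems(4) un less by (intro ends_Un) auto
      then show ?thesis using un by simp
    qed
    finally show ?thesis .
  qed simp
qed

text \<open>Closed, half-open and open members contribute 1, 0 and -1 to the Euler characteristic,
  and that of the whole line is -1.\<close>

lemma finite_partition_count:
  assumes P: "interval_partition P" and fin: "finite P"
  shows "card {I\<in>P. closed_iv I} + 1 = card {I\<in>P. open_iv I}"
proof -
  have "\<Union>P = UNIV" using P by (simp add: interval_partition_def)
  have "int (card {I\<in>P. closed_iv I}) - int (card {I\<in>P. open_iv I})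
      = (\<Sum>I\<in>P. of_bool (closed_iv I)) - (\<Sum>I\<in>P. of_bool (open_iv I))"
    using fin by (simp add: sum_of_bool_eq Int_def conj_commute)
  also have "\<dots> = (\<Sum>I\<in>P. ends I - 1)"
    unfolding sum_subtractf[symmetric]
  proof (rule sum.cong)
    fix I assume "I \<in> P"
    then consider "closed_iv I" | "halfopen_iv I" | "open_iv I"
      using partition_kinds[OF P] by blast
    then show "of_bool (closed_iv I) - of_bool (open_iv I) = ends I - 1"
    proof cases
      case 1
      then show ?thesis using kinds_exclusive(3) by (simp add: ends_closed_iv)
    next
      case 2
      then have "\<not> closed_iv I" using kinds_exclusive(2) by blast
      then show ?thesis using 2 kinds_exclusive(4) by (simp add: ends_halfopen_iv)
    next
      case 3
      then have "\<not> closed_iv I" using kinds_exclusive(3) by blast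
      then show ?thesis using 3 by (simp add: ends_open open_iv_topological)
    qed
  qed simp
  also have "\<dots> = ends (\<Union>P) - 1"
    using P fin \<open>\<Union>P = UNIV\<close> by (intro ends_Union) (auto simp: interval_partition_def)
  also have "\<dots> = -1"
    unfolding \<open>\<Union>P = UNIV\<close> by (simp add: ends_open)
  finally show ?thesis by linarith
qed

section \<open>The type of a countable partition\<close>

lemma countable_partition_type:
  assumes P: "interval_partition P" and "countable P"
  shows "\<exists>\<theta>\<in>Q1. has_type P \<theta>"
proof -
  define a b c d where "a = ecard {I\<in>P. singleton_iv I}" and "b = ecard {I\<in>P. compact_iv I}"
    and "c = ecard {I\<in>P. halfopen_iv I}" and "d = ecard {I\<in>P. open_iv I}"
  have ab: "ecard {I\<in>P. closed_iv I} = a + b"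
  proof -
    have "{I\<in>P. closed_iv I} = {I\<in>P. singleton_iv I} \<union> {I\<in>P. compact_iv I}"
      by (auto simp: closed_iv_def)
    then show ?thesis
      unfolding a_def b_def using kinds_exclusive(1) by (simp add: ecard_Un_disjoint disjoint_iff)
  qed
  have "d \<le> a + b + 1"
    unfolding ab[symmetric] d_def
  proof (rule members_interlaced[OF P])
    fix I J x y
    assume "I \<in> {I\<in>P. open_iv I}" "J \<in> {I\<in>P. open_iv I}" "I \<noteq> J" "x \<in> I" "y \<in> J" "x < y"
    then show "\<exists>K\<in>{I\<in>P. closed_iv I}. K \<subseteq> {x<..<y}"
      using closed_between_opens[OF P, of I J x y] by blast
  qed auto
  \<comment> \<open>For finite \<open>c\<close>, strict inequality would make \<open>d\<close>
    finite, hence \<open>P\<close> finite by interlacing, and then the Euler count would give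
    equality after all. So equality holds whenever \<open>c\<close> is finite.\<close>
  moreover have "a + b + 1 = d" if "c \<noteq> \<infinity>" "d < a + b + 1"
  proof -
    have half: "finite {I\<in>P. halfopen_iv I}" using \<open>c \<noteq> \<infinity>\<close> by (simp add: c_def ecard_def split: if_splits)
    \<comment> \<open>In \<open>enat\<close> only finite values have something strictly above
      them.\<close>
    have "d \<noteq> \<infinity>" using \<open>d < a + b + 1\<close> by (metis enat_ord_code(4) enat_ord_simps(6))
    then have op: "finite {I\<in>P. open_iv I}" by (simp add: d_def ecard_def split: if_splits)
    have "finite {I\<in>P. \<not> closed_iv I}"
      by (rule finite_subset[OF _ finite_UnI[OF half op]]) (use partition_kinds[OF P] in blast)
    moreover have "ecard {I\<in>P. closed_iv I} \<le> ecard {I\<in>P. \<not> closed_iv I} + 1"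
    proof (rule members_interlaced[OF P])
      fix I J x y
      assume "I \<in> {I\<in>P. closed_iv I}" "J \<in> {I\<in>P. closed_iv I}" "I \<noteq> J" "x \<in> I" "y \<in> J" "x < y"
      then show "\<exists>K\<in>{I\<in>P. \<not> closed_iv I}. K \<subseteq> {x<..<y}"
        using nonclosed_between_closeds[OF P \<open>countable P\<close>, of I J x y] by blast
    qed auto
    ultimately have "finite {I\<in>P. closed_iv I}"
      by (auto simp: ecard_def one_enat_def split: if_splits)
    moreover have "P = {I\<in>P. closed_iv I} \<union> {I\<in>P. \<not> closed_iv I}" by blast
    ultimately have "finite P"
      using \<open>finite {I\<in>P. \<not> closed_iv I}\<close> by (metis finite_UnI)
    then show ?thesis
      using finite_partition_count[OF P] ab
      by (simp add: d_def ecard_def one_enat_def flip: ab)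
  qed
  ultimately have "(Om a, Om b, Om c, Om d) \<in> Q1"
    unfolding Q1_def by (cases "c = \<infinity>") force+
  moreover have "has_type P (Om a, Om b, Om c, Om d)"
    using \<open>countable P\<close> by (simp add: has_type_def has_size_cv_Om a_def b_def c_def d_def)
  ultimately show ?thesis by blast
qed

section \<open>Uncountable partitions\<close>

text \<open>The set \<open>N\<close> embeds into \<open>A\<close>, and an infinite set absorbs a set
  that is no larger.\<close>

lemma lepoll_Un_countable:
  assumes "S \<lesssim> A \<union> N" "countable N" "infinite A"
  shows "S \<lesssim> A"
proof -
  have "N \<lesssim> A"
    using assms(2,3) unfolding countable_def infinite_le_lepoll
    by (metis lepoll_def lepoll_trans subset_UNIV)
  then have "(card_of N, card_of A) \<in> ordLeq"
    using card_of_ordLeq by (auto simp: lepoll_def)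
  then have "(card_of (A \<union> N), card_of A) \<in> ordLeq"
    using assms(3) card_of_refl ordIso_imp_ordLeq
    by (intro card_of_Un_ordLeq_infinite_Field) (auto simp: Field_card_of card_of_card_order_on)
  then show ?thesis
    using assms(1) unfolding lepoll_def card_of_ordLeq by (rule ordLeq_transitive[rotated])
qed

text \<open>This is the Cantor-Bendixson argument: delete all open sets whose trace on
  \<open>C\<close> is countable. By Lindelof they remove only countably many points of
  \<open>C\<close>, and the remainder \<open>K\<close> is nonempty and perfect.\<close>

lemma uncountable_closed_lepoll:
  fixes C :: "real set"
  assumes "closed C" "uncountable C"
  shows "(UNIV :: real set) \<lesssim> C"
proof -
  define F where "F = {U. open U \<and> countable (U \<inter> C)}"
  obtain F' where F': "F' \<subseteq> F" "countable F'" "\<Union>F' = \<Union>F"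
    using Lindelof[of F] unfolding F_def by blast
  define K where "K = C - \<Union>F"
  have "C \<inter> \<Union>F = (\<Union>U\<in>F'. U \<inter> C)" using F' by blast
  moreover have "countable (U \<inter> C)" if "U \<in> F'" for U
    using that F' unfolding F_def by blast
  ultimately have cF: "countable (C \<inter> \<Union>F)"
    using countable_UN[OF F'(2), of "\<lambda>U. U \<inter> C"] by simp
  have "closed K" unfolding K_def by (rule closed_Diff[OF \<open>closed C\<close>]) (auto simp: F_def)
  have "K \<noteq> {}"
    using cF \<open>uncountable C\<close> unfolding K_def by (metis Diff_eq_empty_iff inf.absorb1)
  have "euclidean derived_set_of K = K"
  proof
    show "euclidean derived_set_of K \<subseteq> K"
      using \<open>closed K\<close> by (simp add: derived_set_subset)
    show "K \<subseteq> euclidean derived_set_of K"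
    proof
      fix x assume "x \<in> K"
      \<comment> \<open>If \<open>x\<close> were the only point of \<open>K\<close> in
        \<open>T\<close>, the trace of \<open>T\<close> on \<open>C\<close> would be countable, and
        \<open>T\<close> would have been deleted.\<close>
      have "\<exists>y. y \<noteq> x \<and> y \<in> K \<and> y \<in> T" if "x \<in> T" "open T" for T
      proof (rule ccontr)
        assume "\<not> ?thesis"
        then have "T \<inter> C \<subseteq> insert x (C \<inter> \<Union>F)" unfolding K_def by blast
        then have "countable (T \<inter> C)" by (rule countable_subset) (use cF in simp)
        then have "T \<in> F" using \<open>open T\<close> by (simp add: F_def)
        then show False using \<open>x \<in> T\<close> \<open>x \<in> K\<close> by (auto simp: K_def)
      qed
      then show "x \<in> euclidean derived_set_of K" by (auto simp: derived_set_of_def)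
    qed
  qed
  then have "(UNIV :: real set) \<lesssim> K"
    using lepoll_perfect_set[of euclidean K] \<open>K \<noteq> {}\<close> completely_metrizable_space_euclidean by blast
  then show ?thesis
    using lepoll_trans subset_imp_lepoll[of K C] unfolding K_def by blast
qed

text \<open>An interval with two points has nonempty interior, and disjoint sets with nonempty
  interior form a countable family.\<close>

lemma partition_nonsingletons_countable:
  assumes P: "interval_partition P"
  shows "countable {I\<in>P. \<not> singleton_iv I}"
proof (rule countable_disjoint_nonempty_interior_subsets)
  have "interior I \<noteq> {}" if "I \<in> P" "\<not> singleton_iv I" for I
  proof -
    have "uncountable I"
      using partition_kinds[OF P \<open>I \<in> P\<close>] \<open>\<not> singleton_iv I\<close>
        halfopen_iv_topological[of I] open_iv_topological[of I] compact_iv_topological[of I]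
      by (auto simp: closed_iv_def)
    then obtain x y where "x \<in> I" "y \<in> I" "x < y"
      by (metis countable_empty countable_insert insertI1 linorder_neqE_linordered_idom
          subsetI subset_singleton_iff)
    then have "{x<..<y} \<subseteq> I"
      using partition_convex[OF P \<open>I \<in> P\<close>, of x y] by (auto intro: less_imp_le)
    then have "{x<..<y} \<subseteq> interior I" by (simp add: interior_maximal)
    moreover have "(x + y) / 2 \<in> {x<..<y}" using \<open>x < y\<close> by simp
    ultimately show ?thesis by blast
  qed
  then show "interior I = {} \<Longrightarrow> I = {}" if "I \<in> {I\<in>P. \<not> singleton_iv I}" for I
    using that by blast
  show "pairwise disjnt {I\<in>P. \<not> singleton_iv I}"
    unfolding pairwise_def disjnt_def using partition_unique[OF P] by blast
qed

text \<open>The complement \<open>C\<close> of all interiors is closed and contains the set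
  \<open>A\<close> of points that form singletons. It exceeds \<open>A\<close> only by end points of
  the countably many other members, so \<open>A\<close> inherits the size of
  \<open>C\<close>.\<close>

lemma uncountable_partition_singletons:
  assumes P: "interval_partition P" and "uncountable P"
  shows "{I\<in>P. singleton_iv I} \<approx> (UNIV :: real set)"
proof -
  define D where "D = {I\<in>P. \<not> singleton_iv I}"
  have D: "countable D" unfolding D_def by (rule partition_nonsingletons_countable[OF P])
  define A where "A = {x. {x} \<in> P}"
  have img: "(\<lambda>x. {x}) ` A = {I\<in>P. singleton_iv I}" by (auto simp: A_def singleton_iv_def)
  have A_poll: "A \<approx> {I\<in>P. singleton_iv I}"
    unfolding img[symmetric] by (rule eqpoll_sym, rule inj_on_image_eqpoll_self) simp
  have "uncountable {I\<in>P. singleton_iv I}"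
  proof
    assume "countable {I\<in>P. singleton_iv I}"
    then have "countable ({I\<in>P. singleton_iv I} \<union> D)" using D by blast
    moreover have "{I\<in>P. singleton_iv I} \<union> D = P" by (auto simp: D_def)
    ultimately show False using \<open>uncountable P\<close> by simp
  qed
  then have "uncountable A" using img countable_image by metis
  define C where "C = - (\<Union>I\<in>P. interior I)"
  define N where "N = (\<Union>I\<in>D. I - interior I)"
  have "closed C" unfolding C_def by (intro closed_Compl) auto
  have "A \<subseteq> C"
  proof
    fix x assume "x \<in> A"
    then have "{x} \<in> P" by (simp add: A_def)
    have "x \<notin> interior I" if "I \<in> P" for I
    proof
      assume "x \<in> interior I"
      then have "I = {x}"
        using partition_unique[OF P that \<open>{x} \<in> P\<close>, of x] interior_subset by blast
      then show False using \<open>x \<in> interior I\<close> by simp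
    qed
    then show "x \<in> C" by (simp add: C_def)
  qed
  have "C \<subseteq> A \<union> N"
  proof
    fix x assume "x \<in> C"
    obtain I where I: "I \<in> P" "x \<in> I" using partition_member[OF P] .
    show "x \<in> A \<union> N"
    proof (cases "singleton_iv I")
      case True
      then show ?thesis using I by (auto simp: A_def singleton_iv_def)
    next
      case False
      then show ?thesis using I \<open>x \<in> C\<close> by (auto simp: C_def N_def D_def)
    qed
  qed
  have "countable (I - interior I)" if "I \<in> D" for I
  proof -
    have "is_interval I" using that P by (auto simp: D_def interval_partition_def)
    then obtain a b where "I = {} \<or> I = UNIV \<or> I = {..<b} \<or> I = {..b} \<or> I = {a<..} \<or> I = {a..} \<or>
      I = {a<..<b} \<or> I = {a<..b} \<or> I = {a..<b} \<or> I = {a..b}"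
      using is_real_interval[of I] by blast
    \<comment> \<open>Apart from the trivial cases, \<open>I\<close> lies between an interval
      without its end points and the same interval with them, so at most \<open>a\<close> and
      \<open>b\<close> are outside the interior.\<close>
    then have "{a<..<b} \<subseteq> I \<and> I \<subseteq> {a..b} \<or> {..<b} \<subseteq> I \<and> I \<subseteq> {..b} \<or> {a<..} \<subseteq> I \<and> I \<subseteq> {a..}
        \<or> I \<in> {{}, UNIV}"
      by (elim disjE; hypsubst) (simp_all add: less_imp_le subset_iff)
    then have "I - interior I \<subseteq> {a, b}"
    proof (elim disjE conjE)
      assume I: "{a<..<b} \<subseteq> I" "I \<subseteq> {a..b}"
      then have "{a<..<b} \<subseteq> interior I" by (simp add: interior_maximal)
      then show ?thesis using I(2) by force
    next
      assume I: "{..<b} \<subseteq> I" "I \<subseteq> {..b}"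
      then have "{..<b} \<subseteq> interior I" by (simp add: interior_maximal)
      then show ?thesis using I(2) by force
    next
      assume I: "{a<..} \<subseteq> I" "I \<subseteq> {a..}"
      then have "{a<..} \<subseteq> interior I" by (simp add: interior_maximal)
      then show ?thesis using I(2) by force
    qed auto
    then show ?thesis by (rule countable_subset) simp
  qed
  then have "countable N" using D by (simp add: N_def)
  have "(UNIV :: real set) \<lesssim> C"
    using uncountable_closed_lepoll[OF \<open>closed C\<close>] \<open>A \<subseteq> C\<close> \<open>uncountable A\<close> countable_subset[of A C] by blast
  then have "(UNIV :: real set) \<lesssim> A \<union> N"
    using \<open>C \<subseteq> A \<union> N\<close> lepoll_trans subset_imp_lepoll by blast
  then have "(UNIV :: real set) \<lesssim> A"
    using lepoll_Un_countable \<open>countable N\<close> \<open>uncountable A\<close> countable_finite by blast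
  then have "A \<approx> (UNIV :: real set)"
    by (simp add: lepoll_antisym subset_imp_lepoll)
  then show ?thesis using A_poll eqpoll_sym eqpoll_trans by blast
qed

lemma uncountable_partition_type:
  assumes P: "interval_partition P" and "uncountable P"
  shows "\<exists>\<theta>\<in>Q2. has_type P \<theta>"
proof -
  have sub: "countable {I\<in>P. \<phi> I}" if "\<And>I. \<phi> I \<Longrightarrow> \<not> singleton_iv I" for \<phi>
    by (rule countable_subset[OF _ partition_nonsingletons_countable[OF P]]) (use that in auto)
  have "countable {I\<in>P. compact_iv I}" "countable {I\<in>P. halfopen_iv I}" "countable {I\<in>P. open_iv I}"
    using kinds_exclusive by (auto intro!: sub simp: closed_iv_def)
  then have "has_type P (Cont, Om (ecard {I\<in>P. compact_iv I}), Om (ecard {I\<in>P. halfopen_iv I}),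
      Om (ecard {I\<in>P. open_iv I}))"
    using uncountable_partition_singletons[OF assms]
    by (simp add: has_type_def has_size_cv_Om) (simp add: has_size_cv_def)
  then show ?thesis unfolding Q2_def by blast
qed

section \<open>Construction of partitions\<close>

text \<open>A relative version of \<open>interval_partition\<close>: regions of the line are
  partitioned separately and glued by \<open>partitions_UN\<close>.\<close>

definition partitions :: "real set set \<Rightarrow> real set \<Rightarrow> bool" where
  "partitions Q S \<longleftrightarrow> (\<forall>I\<in>Q. I \<noteq> {} \<and> is_interval I) \<and>
     (\<forall>I\<in>Q. \<forall>J\<in>Q. I \<noteq> J \<longrightarrow> I \<inter> J = {}) \<and> \<Union>Q = S"

lemma interval_partition_iff: "interval_partition P \<longleftrightarrow> partitions P UNIV"
  by (simp add: interval_partition_def partitions_def)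

lemma partitions_singleton: "I \<noteq> {} \<Longrightarrow> is_interval I \<Longrightarrow> partitions {I} I"
  by (simp add: partitions_def)

lemma partitions_pair:
  "A \<noteq> {} \<Longrightarrow> is_interval A \<Longrightarrow> C \<noteq> {} \<Longrightarrow> is_interval C \<Longrightarrow> A \<inter> C = {} \<Longrightarrow> A \<union> C = S \<Longrightarrow>
    partitions {A, C} S"
  by (auto simp: partitions_def)

lemma partitions_points: "partitions ((\<lambda>x. {x}) ` S) S"
  by (auto simp: partitions_def is_interval_1)

lemma partitions_UN:
  assumes parts: "\<And>i. i \<in> X \<Longrightarrow> partitions (B i) (reg i)"
    and disj: "\<And>i j. i \<in> X \<Longrightarrow> j \<in> X \<Longrightarrow> i \<noteq> j \<Longrightarrow> reg i \<inter> reg j = {}"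
  shows "partitions (\<Union>i\<in>X. B i) (\<Union>i\<in>X. reg i)"
  unfolding partitions_def
proof (intro conjI ballI impI)
  fix I J assume "I \<in> (\<Union>i\<in>X. B i)" "J \<in> (\<Union>i\<in>X. B i)" and ne: "I \<noteq> J"
  then obtain i j where ij: "i \<in> X" "I \<in> B i" "j \<in> X" "J \<in> B j" by blast
  then have "I \<subseteq> reg i" "J \<subseteq> reg j" using parts unfolding partitions_def by blast+
  show "I \<inter> J = {}"
  proof (cases "i = j")
    case True
    then show ?thesis using ij ne parts[OF ij(1)] unfolding partitions_def by simp
  next
    case False
    then show ?thesis using disj[OF ij(1,3)] \<open>I \<subseteq> reg i\<close> \<open>J \<subseteq> reg j\<close> by blast
  qed
next
  show "\<Union>(\<Union>i\<in>X. B i) = (\<Union>i\<in>X. reg i)"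
  proof -
    have "\<Union>(B i) = reg i" if "i \<in> X" for i using parts[OF that] by (simp add: partitions_def)
    moreover have "\<Union>(\<Union>i\<in>X. B i) = (\<Union>i\<in>X. \<Union>(B i))" by blast
    ultimately show ?thesis by simp
  qed
next
  fix I assume "I \<in> (\<Union>i\<in>X. B i)"
  then obtain i where "i \<in> X" "I \<in> B i" by blast
  then show "I \<noteq> {}" "is_interval I" using parts[of i] unfolding partitions_def by blast+
qed

text \<open>The members of \<open>P\<close> serve as regions for gluing; those outside
  \<open>D\<close> are partitioned trivially.\<close>

lemma partition_refine:
  assumes P: "interval_partition P"
    and "\<And>I. I \<in> D \<Longrightarrow> partitions (R I) I" and "D \<subseteq> P"
  shows "interval_partition ((P - D) \<union> (\<Union>I\<in>D. R I))"
proof -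
  have "partitions (\<Union>I\<in>P. if I \<in> D then R I else {I}) (\<Union>I\<in>P. I)"
    using assms by (intro partitions_UN) (auto simp: interval_partition_def intro!: partitions_singleton)
  moreover have "(\<Union>I\<in>P. if I \<in> D then R I else {I}) = (P - D) \<union> (\<Union>I\<in>D. R I)"
    using \<open>D \<subseteq> P\<close> by (auto split: if_splits)
  moreover have "(\<Union>I\<in>P. I) = UNIV" using P by (simp add: interval_partition_def)
  ultimately show ?thesis by (simp add: interval_partition_iff)
qed

text \<open>Since the kinds exclude each other, a decomposition into four homogeneous families is
  the decomposition by kind. This reads off the type of an explicit partition.\<close>

lemma members_by_kind:
  assumes "P = S \<union> C \<union> H \<union> W" "\<And>I. I \<in> S \<Longrightarrow> singleton_iv I" "\<And>I. I \<in> C \<Longrightarrow> compact_iv I"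
    and "\<And>I. I \<in> H \<Longrightarrow> halfopen_iv I" "\<And>I. I \<in> W \<Longrightarrow> open_iv I"
  shows "{I\<in>P. singleton_iv I} = S" "{I\<in>P. compact_iv I} = C"
    and "{I\<in>P. halfopen_iv I} = H" "{I\<in>P. open_iv I} = W"
proof -
  have "(I \<in> S \<longrightarrow> \<not> compact_iv I \<and> \<not> halfopen_iv I \<and> \<not> open_iv I) \<and>
      (I \<in> C \<longrightarrow> \<not> singleton_iv I \<and> \<not> halfopen_iv I \<and> \<not> open_iv I) \<and>
      (I \<in> H \<longrightarrow> \<not> singleton_iv I \<and> \<not> compact_iv I \<and> \<not> open_iv I) \<and>
      (I \<in> W \<longrightarrow> \<not> singleton_iv I \<and> \<not> compact_iv I \<and> \<not> halfopen_iv I)" for I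
    using assms(2-5)[of I] kinds_exclusive[of I] unfolding closed_iv_def by argo
  then show "{I\<in>P. singleton_iv I} = S" "{I\<in>P. compact_iv I} = C"
    "{I\<in>P. halfopen_iv I} = H" "{I\<in>P. open_iv I} = W"
    using assms by auto
qed

lemma partition_Un_kinds:
  assumes "interval_partition P"
  shows "P = {I\<in>P. singleton_iv I} \<union> {I\<in>P. compact_iv I} \<union> {I\<in>P. halfopen_iv I} \<union> {I\<in>P. open_iv I}"
  using partition_kinds[OF assms] unfolding closed_iv_def by blast

section \<open>Cutting open members\<close>

text \<open>A strictly decreasing sequence running towards the left end of \<open>U\<close> cuts it
  into the intervals \<open>[f (k + 1), f k)\<close> and a rightmost piece starting at
  \<open>f 0\<close>.\<close>

lemma open_split_halfopen:
  assumes "open_iv U"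
  shows "\<exists>Q. partitions Q U \<and> (\<forall>I\<in>Q. halfopen_iv I) \<and> infinite Q \<and> countable Q"
proof -
  have "\<exists>f::nat \<Rightarrow> real. (\<forall>k. f (Suc k) < f k) \<and> (\<forall>k. f k \<in> U) \<and> (\<forall>x\<in>U. \<exists>k. f k \<le> x)"
  proof -
    \<comment> \<open>Either the left end is a real \<open>a\<close> and the sequence is
      \<open>a + e / (k + 1)\<close>, with \<open>e\<close> small enough to stay in
      \<open>U\<close>, or \<open>U\<close> is unbounded below and the sequence is
      \<open>a - (k + 1)\<close>.\<close>
    consider a e where "0 < e" "\<And>x. a < x \<Longrightarrow> x \<le> a + e \<Longrightarrow> x \<in> U" "U \<subseteq> {a<..}"
      | a where "{..<a} \<subseteq> U"
    proof -
      from assms consider a b where "a < b" "U = {a<..<b}" | t where "U = {t<..}"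
        | t where "U = {..<t}" | "U = UNIV"
        unfolding open_iv_def by blast
      then show ?thesis
      proof cases
        case (1 a b)
        show ?thesis by (rule that(1)[of "(b - a) / 2" a]) (use 1 in \<open>auto simp: field_simps\<close>)
      next
        case (2 t)
        show ?thesis by (rule that(1)[of 1 t]) (use 2 in auto)
      qed (use that(2) in auto)
    qed
    then show ?thesis
    proof cases
      case (1 a e)
      have "\<exists>k. a + e / real (Suc k) \<le> x" if "x \<in> U" for x
      proof -
        have "0 < (x - a) / e" using that 1 by auto
        then obtain k where "inverse (real (Suc k)) < (x - a) / e" using reals_Archimedean by blast
        then have "a + e / real (Suc k) \<le> x" using \<open>0 < e\<close> by (simp add: field_simps)
        then show ?thesis ..
      qed
      moreover have "a + e / real (Suc (Suc k)) < a + e / real (Suc k)" for k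
        using \<open>0 < e\<close> by (simp add: frac_less2)
      moreover have "a + e / real (Suc k) \<in> U" for k
        using \<open>0 < e\<close> by (intro 1(2)) (auto simp: field_simps)
      ultimately show ?thesis by (intro exI[of _ "\<lambda>k. a + e / real (Suc k)"]) blast
    next
      case (2 a)
      have "\<exists>k. a - real (Suc k) \<le> x" for x
      proof -
        obtain k where "a - x < real k" using reals_Archimedean2 by blast
        then have "a - real (Suc k) \<le> x" by simp
        then show ?thesis ..
      qed
      moreover have "a - real (Suc k) \<in> U" for k using 2 by auto
      ultimately show ?thesis by (intro exI[of _ "\<lambda>k. a - real (Suc k)"]) auto
    qed
  qed
  then obtain f :: "nat \<Rightarrow> real" where dec: "\<And>k. f (Suc k) < f k" and fU: "\<And>k. f k \<in> U"
    and cofinal: "\<And>x. x \<in> U \<Longrightarrow> \<exists>k. f k \<le> x" by blast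
  have mono: "f j \<le> f i" if "i \<le> j" for i j
    using decseqD[OF decseq_SucI that, of f] dec by (simp add: less_imp_le)
  have conv: "y \<in> U" if "x \<in> U" "x \<le> y" "y \<le> z" "z \<in> U" for x y z
    using assms that unfolding open_iv_def by auto
  define reg where "reg i = (case i of 0 \<Rightarrow> U \<inter> {f 0..} | Suc k \<Rightarrow> {f (Suc k)..<f k})" for i
  have half: "halfopen_iv (reg i)" for i
  proof (cases i)
    case 0
    have "U \<inter> {f 0..} = {f 0..} \<or> (\<exists>b. f 0 < b \<and> U \<inter> {f 0..} = {f 0..<b})"
    proof -
      from assms consider a b where "a < b" "U = {a<..<b}" | t where "U = {t<..}"
        | t where "U = {..<t}" | "U = UNIV"
        unfolding open_iv_def by blast
      then show ?thesis
      proof cases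
        case (1 a b)
        then show ?thesis using fU[of 0] by (intro disjI2 exI[of _ b]) auto
      next
        case (2 t)
        then show ?thesis using fU[of 0] by (intro disjI1) auto
      next
        case (3 t)
        then show ?thesis using fU[of 0] by (intro disjI2 exI[of _ t]) auto
      qed auto
    qed
    then show ?thesis unfolding 0 reg_def halfopen_iv_def by auto
  next
    case (Suc k)
    then show ?thesis using dec[of k] unfolding reg_def halfopen_iv_def by auto
  qed
  have disj: "reg i \<inter> reg j = {}" if "i < j" for i j
  proof -
    obtain m where j: "j = Suc m" using \<open>i < j\<close> less_imp_Suc_add by blast
    have "reg i \<subseteq> {f i..}" by (auto simp: reg_def split: nat.splits)
    moreover have "reg j \<subseteq> {..<f i}" using mono[of i m] that j by (auto simp: reg_def)
    ultimately show ?thesis by fastforce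
  qed
  have "partitions (\<Union>i. {reg i}) (\<Union>i. reg i)"
  proof (rule partitions_UN)
    fix i
    have "reg i \<noteq> {}" using halfopen_iv_topological(3)[OF half[of i]] by auto
    moreover have "is_interval (reg i)"
      using half[of i] unfolding halfopen_iv_def by (elim disjE exE conjE; simp)
    ultimately show "partitions {reg i} (reg i)" by (rule partitions_singleton)
  next
    fix i j :: nat assume "i \<noteq> j"
    then show "reg i \<inter> reg j = {}" using disj by (metis Int_commute linorder_neqE_nat)
  qed
  moreover have "(\<Union>i. reg i) = U"
  proof
    have "reg i \<subseteq> U" for i
    proof (cases i)
      case (Suc k)
      show ?thesis
      proof
        fix x assume "x \<in> reg i"
        then show "x \<in> U" using conv[OF fU[of "Suc k"] _ _ fU[of k]] by (simp add: reg_def Suc)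
      qed
    qed (simp add: reg_def)
    then show "(\<Union>i. reg i) \<subseteq> U" by blast
    show "U \<subseteq> (\<Union>i. reg i)"
    proof
      fix x assume "x \<in> U"
      \<comment> \<open>The first term that is at most \<open>x\<close> determines the piece
        containing \<open>x\<close>.\<close>
      define k where "k = (LEAST k. f k \<le> x)"
      have k: "f k \<le> x" unfolding k_def using cofinal[OF \<open>x \<in> U\<close>] by (rule LeastI_ex)
      have "x \<in> reg k"
      proof (cases k)
        case 0
        then show ?thesis using k \<open>x \<in> U\<close> by (simp add: reg_def)
      next
        case (Suc j)
        then have "\<not> f j \<le> x" using not_less_Least[of j "\<lambda>k. f k \<le> x"] by (simp add: k_def)
        then show ?thesis using Suc k by (simp add: reg_def)
      qed
      then show "x \<in> (\<Union>i. reg i)" by blast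
    qed
  qed
  moreover have "inj reg"
  proof (rule injI)
    fix i j assume "reg i = reg j"
    moreover have "reg i \<noteq> {}" using halfopen_iv_topological(3)[OF half[of i]] by auto
    ultimately show "i = j" using disj by (metis inf.idem linorder_neqE_nat)
  qed
  then have "infinite (range reg)" by (rule range_inj_infinite)
  moreover have "(\<Union>i. {reg i}) = range reg" by blast
  ultimately show ?thesis using half by (intro exI[of _ "range reg"]) auto
qed

section \<open>The block construction\<close>

text \<open>Labels 0 and 1 mark blocks that begin with a singleton or a compact interval, label 2
  marks blocks that are one half-open member. Each block labelled 0 or 1 yields one open member and
  the initial piece \<open>U 0\<close> yields another, which gives \<open>a + b + 1\<close>.\<close>

lemma partition_with_counts:
  fixes a b c :: enat
  shows "\<exists>P. interval_partition P \<and> countable P \<and> ecard {I\<in>P. singleton_iv I} = a \<and>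
    ecard {I\<in>P. compact_iv I} = b \<and> ecard {I\<in>P. halfopen_iv I} = c \<and>
    ecard {I\<in>P. open_iv I} = a + b + 1"
proof -
  obtain N :: enat and t :: "nat \<Rightarrow> nat" where
    label: "\<And>k. ecard {n. enat n < N \<and> t n = k} =
      (if k = 0 then a else if k = 1 then b else if k = 2 then c else 0)"
    using labelling_exists[of "\<lambda>k. if k = 0 then a else if k = 1 then b else if k = 2 then c else 0"]
    by blast
  define L where "L k = {n. enat n < N \<and> t n = k}" for k
  have L: "ecard (L 0) = a" "ecard (L 1) = b" "ecard (L 2) = c"
    unfolding L_def label by auto
  \<comment> \<open>All other labels were given the count 0.\<close>
  have t: "t n = 0 \<or> t n = 1 \<or> t n = 2" if "enat n < N" for n
  proof (rule ccontr)
    assume "\<not> ?thesis"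
    then have "ecard {m. enat m < N \<and> t m = t n} = 0" unfolding label by auto
    then have "{m. enat m < N \<and> t m = t n} = {}"
      by (auto simp: ecard_def zero_enat_def split: if_splits)
    then show False using that by blast
  qed
  \<comment> \<open>The last of finitely many blocks extends to infinity; without blocks, \<open>U 0\<close> is the whole line.\<close>
  define U where "U i = (if enat i < N then {..<real i} else UNIV)" for i
  \<comment> \<open>Indices are shifted by one: region 0 is the initial piece and region
    \<open>Suc n\<close> is the block starting at \<open>n\<close>. Hence \<open>X\<close> includes
    the index \<open>N\<close> itself when \<open>N\<close> is finite.\<close>
  define reg where "reg i = (case i of 0 \<Rightarrow> U 0 | Suc n \<Rightarrow> {real n..} \<inter> U (Suc n))" for i
  \<comment> \<open>The open remainder of block \<open>n\<close>, after a closed member ending at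
    \<open>n\<close> or at \<open>n + 1/2\<close>.\<close>
  define V where "V n = {real n + (if t n = 0 then 0 else 1/2)<..} \<inter> U (Suc n)" for n
  define B where "B i = (case i of 0 \<Rightarrow> {U 0} | Suc n \<Rightarrow>
      if t n = 0 then {{real n}, V n} else if t n = 1 then {{real n..real n + 1/2}, V n}
      else {reg (Suc n)})" for i
  define X where "X = {i. enat i \<le> N}"
  have U_cases: "U (Suc n) = UNIV \<or> U (Suc n) = {..<real n + 1}" for n
    by (auto simp: U_def)
  have disj: "reg i \<inter> reg j = {}" if "i \<in> X" "j \<in> X" "i < j" for i j
  proof -
    obtain m where j: "j = Suc m" using \<open>i < j\<close> less_imp_Suc_add by blast
    have "enat i < N" using that unfolding X_def
      by (metis enat_ord_simps(2) mem_Collect_eq order_less_le_trans)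
    then have "reg i \<subseteq> {..<real i}" by (auto simp: reg_def U_def split: nat.splits)
    moreover have "reg j \<subseteq> {real i..}" using that j by (auto simp: reg_def)
    ultimately show ?thesis by fastforce
  qed
  \<comment> \<open>The point \<open>n + 3/4\<close> is beyond both possible cuts and inside the
    block; it also serves as a witness for injectivity below.\<close>
  have V_inter: "real n + 3/4 \<in> V n" for n
    using U_cases[of n] unfolding V_def by (elim disjE) simp_all
  have V_interval: "is_interval (V n)" for n
  proof -
    have "is_interval (U (Suc n))" using U_cases[of n] by (elim disjE) simp_all
    then show ?thesis unfolding V_def by (intro is_interval_Int) simp_all
  qed
  have parts: "partitions (B i) (reg i)" for i
  proof (cases i)
    case 0
    have "- 1 \<in> U 0" "is_interval (U 0)" by (auto simp: U_def)
    then have "partitions {U 0} (U 0)" by (intro partitions_singleton) auto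
    then show ?thesis using 0 by (simp add: B_def reg_def)
  next
    case (Suc n)
    have n: "real n + 1/2 \<in> U (Suc n)" "real n \<in> U (Suc n)" "is_interval (U (Suc n))"
      and down: "\<And>x y. x \<in> U (Suc n) \<Longrightarrow> y \<le> x \<Longrightarrow> y \<in> U (Suc n)"
      using U_cases[of n] by (elim disjE; simp)+
    consider "t n = 0" | "t n = 1" | "t n \<noteq> 0" "t n \<noteq> 1" by blast
    then have "partitions (B (Suc n)) ({real n..} \<inter> U (Suc n))"
    proof cases
      case 1
      have "partitions {{real n}, V n} ({real n..} \<inter> U (Suc n))"
      proof (rule partitions_pair)
        show "V n \<noteq> {}" using V_inter by blast
        show "is_interval (V n)" by (rule V_interval)
        show "{real n} \<inter> V n = {}" using 1 by (simp add: V_def)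
        show "{real n} \<union> V n = {real n..} \<inter> U (Suc n)"
          using 1 n(2) by (auto simp: V_def)
      qed (simp_all add: is_interval_1)
      then show ?thesis using 1 by (simp add: B_def)
    next
      case 2
      have "partitions {{real n..real n + 1/2}, V n} ({real n..} \<inter> U (Suc n))"
      proof (rule partitions_pair)
        show "V n \<noteq> {}" using V_inter by blast
        show "is_interval (V n)" by (rule V_interval)
        show "{real n..real n + 1/2} \<inter> V n = {}" using 2 by (auto simp: V_def)
        show "{real n..real n + 1/2} \<union> V n = {real n..} \<inter> U (Suc n)"
          using 2 down[OF n(1)] by (auto simp: V_def)
      qed simp_all
      then show ?thesis using 2 by (simp add: B_def)
    next
      case 3
      have "partitions {{real n..} \<inter> U (Suc n)} ({real n..} \<inter> U (Suc n))"
        using n by (intro partitions_singleton is_interval_Int) auto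
      then show ?thesis using 3 by (simp add: B_def reg_def)
    qed
    then show ?thesis by (simp add: Suc reg_def)
  qed
  define P where "P = (\<Union>i\<in>X. B i)"
  have "partitions P (\<Union>i\<in>X. reg i)"
    unfolding P_def
  proof (rule partitions_UN)
    fix i j assume "i \<in> X" "j \<in> X" "i \<noteq> j"
    then show "reg i \<inter> reg j = {}" using disj by (metis Int_commute linorder_neqE_nat)
  qed (rule parts)
  moreover have "(\<Union>i\<in>X. reg i) = UNIV"
  proof (rule UNIV_eq_I[symmetric])
    fix x
    \<comment> \<open>The first \<open>U i\<close> that contains \<open>x\<close> determines the
      region: if \<open>i = Suc n\<close>, then failure for \<open>n\<close> gives both
      \<open>n < N\<close> and \<open>n \<le> x\<close>.\<close>
    define i where "i = (LEAST i. x \<in> U i)"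
    obtain k where "x < real k" using reals_Archimedean2 by blast
    then have "x \<in> U k" by (simp add: U_def)
    then have i: "x \<in> U i" unfolding i_def by (rule LeastI)
    have prev: "x \<notin> U j" if "j < i" for j
      using that not_less_Least unfolding i_def by blast
    have "i \<in> X \<and> x \<in> reg i"
    proof (cases i)
      case (Suc n)
      then have "enat n < N" "real n \<le> x" using prev[of n] by (auto simp: U_def split: if_splits)
      then show ?thesis using i Suc by (auto simp: X_def reg_def Suc_ile_eq)
    qed (use i in \<open>simp add: X_def reg_def zero_enat_def[symmetric]\<close>)
    then show "x \<in> (\<Union>i\<in>X. reg i)" by blast
  qed
  ultimately have part: "interval_partition P" by (simp add: interval_partition_iff)
  have X_eq: "X = insert 0 (Suc ` {n. enat n < N})"
  proof (rule set_eqI)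
    show "i \<in> X \<longleftrightarrow> i \<in> insert 0 (Suc ` {n. enat n < N})" for i
      by (cases i) (auto simp: X_def Suc_ile_eq zero_enat_def[symmetric])
  qed
  have "{n. enat n < N} = L 0 \<union> L 1 \<union> L 2" using t by (auto simp: L_def)
  then have "P = B 0 \<union> (\<Union>n\<in>L 0. B (Suc n)) \<union> (\<Union>n\<in>L 1. B (Suc n)) \<union> (\<Union>n\<in>L 2. B (Suc n))"
    unfolding P_def X_eq by (simp add: image_image UN_Un Un_assoc)
  moreover have "(\<Union>n\<in>L 0. B (Suc n)) = (\<lambda>n. {real n}) ` L 0 \<union> V ` L 0"
    by (auto simp: B_def L_def)
  moreover have "(\<Union>n\<in>L 1. B (Suc n)) = (\<lambda>n. {real n..real n + 1/2}) ` L 1 \<union> V ` L 1"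
    by (auto simp: B_def L_def)
  moreover have "(\<Union>n\<in>L 2. B (Suc n)) = (\<lambda>n. reg (Suc n)) ` L 2"
    by (auto simp: B_def L_def)
  moreover have "B 0 = {U 0}" by (simp add: B_def)
  ultimately have "P = {U 0} \<union> ((\<lambda>n. {real n}) ` L 0 \<union> V ` L 0) \<union>
      ((\<lambda>n. {real n..real n + 1/2}) ` L 1 \<union> V ` L 1) \<union> (\<lambda>n. reg (Suc n)) ` L 2"
    by (simp only:)
  also have "{u} \<union> (S \<union> A) \<union> (C \<union> A') \<union> H = S \<union> C \<union> H \<union> insert u (A \<union> A')"
    for u :: "real set" and S A C A' H by blast
  finally have P_eq: "P = (\<lambda>n. {real n}) ` L 0 \<union> (\<lambda>n. {real n..real n + 1/2}) ` L 1 \<union>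
      (\<lambda>n. reg (Suc n)) ` L 2 \<union> insert (U 0) (V ` (L 0 \<union> L 1))"
    unfolding image_Un .
  have open_V: "open_iv (V n)" for n
  proof -
    have "V n = {real n + (if t n = 0 then 0 else 1/2)<..} \<or>
        V n = {real n + (if t n = 0 then 0 else 1/2)<..<real n + 1}"
      using U_cases[of n] unfolding V_def by (elim disjE; simp add: greaterThanLessThan_def)
    moreover have "real n + (if t n = 0 then 0 else 1/2) < real n + 1" by simp
    ultimately show ?thesis unfolding open_iv_def by blast
  qed
  have open_U: "open_iv (U 0)" unfolding U_def open_iv_def by auto
  have half_reg: "halfopen_iv (reg (Suc n))" for n
  proof -
    have "reg (Suc n) = {real n..} \<or> reg (Suc n) = {real n..<real n + 1}"
      using U_cases[of n] unfolding reg_def by (elim disjE; simp add: atLeastLessThan_def)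
    moreover have "real n < real n + 1" by simp
    ultimately show ?thesis unfolding halfopen_iv_def by blast
  qed
  have comp: "compact_iv {real n..real n + 1/2}" for n
    unfolding compact_iv_def by (intro exI[of _ "real n"] exI[of _ "real n + 1/2"]) simp
  have sing: "singleton_iv {real n}" for n unfolding singleton_iv_def by blast
  have kinds:
    "{I\<in>P. singleton_iv I} = (\<lambda>n. {real n}) ` L 0"
    "{I\<in>P. compact_iv I} = (\<lambda>n. {real n..real n + 1/2}) ` L 1"
    "{I\<in>P. halfopen_iv I} = (\<lambda>n. reg (Suc n)) ` L 2"
    "{I\<in>P. open_iv I} = insert (U 0) (V ` (L 0 \<union> L 1))"
    by (rule members_by_kind[OF P_eq]; use sing comp half_reg open_V open_U in blast)+
  have reg_inj: "m = n" if "x \<in> reg (Suc m)" "x \<in> reg (Suc n)" "enat m < N" "enat n < N" for m n x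
    using that disj[of "Suc m" "Suc n"] disj[of "Suc n" "Suc m"]
    by (cases m n rule: linorder_cases) (auto simp: X_eq)
  have V_reg: "V n \<subseteq> reg (Suc n)" for n by (auto simp: V_def reg_def split: if_splits)
  have "inj_on V (L 0 \<union> L 1)"
  proof (rule inj_onI)
    fix m n assume "m \<in> L 0 \<union> L 1" "n \<in> L 0 \<union> L 1" "V m = V n"
    then show "m = n"
      using reg_inj[of "real m + 3/4" m n] V_inter[of m] V_reg[of m] V_reg[of n]
      by (auto simp: L_def)
  qed
  \<comment> \<open>As soon as a block exists, \<open>U 0\<close> is the negative ray, which does
    not contain \<open>n + 3/4\<close>.\<close>
  moreover have "U 0 \<notin> V ` (L 0 \<union> L 1)"
  proof
    assume "U 0 \<in> V ` (L 0 \<union> L 1)"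
    then obtain n where n: "U 0 = V n" "enat n < N" by (auto simp: L_def)
    then have "real n + 3/4 \<in> U 0" using V_inter[of n] by simp
    moreover have "enat 0 < N" using n(2)
      by (metis enat_ord_simps(2) less_nat_zero_code linorder_neqE zero_enat_def not_less_zero)
    ultimately show False by (simp add: U_def)
  qed
  moreover have "L 0 \<inter> L 1 = {}" by (auto simp: L_def)
  ultimately have "ecard (insert (U 0) (V ` (L 0 \<union> L 1))) = a + b + 1"
    using L by (simp add: ecard_insert ecard_image ecard_Un_disjoint del: image_Un)
  moreover have "inj_on (\<lambda>n. reg (Suc n)) (L 2)"
  proof (rule inj_onI)
    fix m n assume "m \<in> L 2" "n \<in> L 2" "reg (Suc m) = reg (Suc n)"
    then show "m = n"
      using reg_inj[of "real m + 3/4" m n] V_inter[of m] V_reg[of m]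
      by (auto simp: L_def)
  qed
  moreover have "countable P" unfolding P_eq by simp
  moreover have "inj_on (\<lambda>n. {real n}) (L 0)" "inj_on (\<lambda>n. {real n..real n + 1/2}) (L 1)"
    by (auto simp: inj_on_def Icc_eq_Icc)
  ultimately show ?thesis
    using part L by (intro exI[of _ P]) (simp add: kinds ecard_image)
qed

section \<open>Realization of the prescribed types\<close>

text \<open>Properness leaves at least one open member to be cut. In an infinite \<open>S\<close>
  one point is set aside first, and the rest still has room for every \<open>d\<close>, including
  \<open>\<infinity>\<close>.\<close>

lemma proper_subset_ecard:
  assumes "d \<le> ecard S" "ecard S = \<infinity> \<or> d < ecard S"
  obtains T where "T \<subset> S" "ecard T = d"
proof (cases "ecard S = \<infinity>")
  case True
  then obtain s where "s \<in> S" by (auto simp: ecard_eq_infinity_iff dest: infinite_imp_nonempty)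
  have "ecard (S - {s}) = \<infinity>" using True by (simp add: ecard_eq_infinity_iff)
  then obtain T where "T \<subseteq> S - {s}" "ecard T = d" using ecard_subset[of d "S - {s}"] by auto
  then show ?thesis using that \<open>s \<in> S\<close> by blast
next
  case False
  then obtain T where "T \<subseteq> S" "ecard T = d" using ecard_subset assms(1) by blast
  moreover have "T \<noteq> S" using False assms(2) \<open>ecard T = d\<close> by auto
  ultimately show ?thesis using that by blast
qed

text \<open>If \<open>d < a + b + 1\<close>, then \<open>d\<close> of the \<open>a + b + 1\<close>
  open members are kept and the others are cut. At least one is cut, so the half-open members become
  infinite in number, while singletons and compact members are unchanged.\<close>

lemma Q1_realized:
  assumes "\<theta> \<in> Q1"
  shows "\<exists>P. interval_partition P \<and> has_type P \<theta>"
proof -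
  obtain a b c d where \<theta>: "\<theta> = (Om a, Om b, Om c, Om d)"
    and "a + b + 1 = d \<or> (a + b + 1 > d \<and> c = \<infinity>)"
    using assms unfolding Q1_def by blast
  then consider "d = a + b + 1" | "d < a + b + 1" "c = \<infinity>" by blast
  then show ?thesis
  proof cases
    case 1
    obtain P where "interval_partition P" "countable P" "ecard {I\<in>P. singleton_iv I} = a"
      "ecard {I\<in>P. compact_iv I} = b" "ecard {I\<in>P. halfopen_iv I} = c"
      "ecard {I\<in>P. open_iv I} = a + b + 1"
      using partition_with_counts[of a b c] by blast
    then show ?thesis
      unfolding \<theta> 1 by (intro exI[of _ P]) (simp add: has_type_def has_size_cv_Om)
  next
    case 2
    obtain P where P: "interval_partition P" "countable P" "ecard {I\<in>P. singleton_iv I} = a"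
      "ecard {I\<in>P. compact_iv I} = b" "ecard {I\<in>P. open_iv I} = a + b + 1"
      using partition_with_counts[of a b 0] by blast
    obtain T where T: "T \<subset> {I\<in>P. open_iv I}" "ecard T = d"
      using proper_subset_ecard[of d "{I\<in>P. open_iv I}"] P(5) 2(1) less_imp_le by metis
    obtain R where R: "\<And>I. open_iv I \<Longrightarrow> partitions (R I) I"
      "\<And>I J. open_iv I \<Longrightarrow> J \<in> R I \<Longrightarrow> halfopen_iv J"
      "\<And>I. open_iv I \<Longrightarrow> infinite (R I) \<and> countable (R I)"
      using open_split_halfopen by metis
    define D where "D = {I\<in>P. open_iv I} - T"
    have D: "D \<subseteq> P" "\<And>I. I \<in> D \<Longrightarrow> open_iv I" by (auto simp: D_def)
    define P' where "P' = (P - D) \<union> (\<Union>I\<in>D. R I)"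
    have part: "interval_partition P'"
      unfolding P'_def using D R(1) by (intro partition_refine[OF P(1)]) auto
    have "P - D = {I\<in>P. singleton_iv I} \<union> {I\<in>P. compact_iv I} \<union> {I\<in>P. halfopen_iv I} \<union> T"
      using partition_Un_kinds[OF P(1)] T(1) kinds_exclusive unfolding D_def closed_iv_def by blast
    then have "P' = {I\<in>P. singleton_iv I} \<union> {I\<in>P. compact_iv I} \<union>
        ({I\<in>P. halfopen_iv I} \<union> (\<Union>I\<in>D. R I)) \<union> T"
      unfolding P'_def by blast
    note kinds = members_by_kind[OF this]
    have kinds: "{I\<in>P'. singleton_iv I} = {I\<in>P. singleton_iv I}"
      "{I\<in>P'. compact_iv I} = {I\<in>P. compact_iv I}"
      "{I\<in>P'. halfopen_iv I} = {I\<in>P. halfopen_iv I} \<union> (\<Union>I\<in>D. R I)"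
      "{I\<in>P'. open_iv I} = T"
      by (rule kinds; use T(1) D R(2) in blast)+
    have "D \<noteq> {}" using T(1) by (auto simp: D_def)
    then obtain I where "I \<in> D" by blast
    then have "infinite (\<Union>I\<in>D. R I)" using R(3) D by (meson UN_upper infinite_super)
    moreover have "countable P'"
      unfolding P'_def using \<open>countable P\<close> D R(3) countable_subset[OF D(1)] by auto
    ultimately have "has_type P' \<theta>"
      using P(3,4) T(2) 2 unfolding \<theta> has_type_def prod.case has_size_cv_Om
      by (simp add: kinds[symmetric] ecard_infinite)
        (simp add: kinds ecard_infinite)
    then show ?thesis using part by blast
  qed
qed

text \<open>Starting from infinitely many open members, \<open>d\<close> of them are kept and the
  others are broken into points, which leaves compact and half-open members unchanged.\<close>

lemma Q2_realized:
  assumes "\<theta> \<in> Q2"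
  shows "\<exists>P. interval_partition P \<and> has_type P \<theta>"
proof -
  obtain b c d where \<theta>: "\<theta> = (Cont, Om b, Om c, Om d)"
    using assms unfolding Q2_def by blast
  \<comment> \<open>With infinitely many singletons, \<open>a + b + 1\<close> is infinite whatever
    \<open>b\<close> is.\<close>
  obtain P where P: "interval_partition P" "countable P" "ecard {I\<in>P. compact_iv I} = b"
    "ecard {I\<in>P. halfopen_iv I} = c" "ecard {I\<in>P. open_iv I} = \<infinity>"
    using partition_with_counts[of \<infinity> b c] by auto
  obtain T where T: "T \<subset> {I\<in>P. open_iv I}" "ecard T = d"
    using proper_subset_ecard[of d "{I\<in>P. open_iv I}"] P(5) by auto
  define R where "R I = (\<lambda>x::real. {x}) ` I" for I
  define D where "D = {I\<in>P. open_iv I} - T"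
  have D: "D \<subseteq> P" "\<And>I. I \<in> D \<Longrightarrow> open_iv I" by (auto simp: D_def)
  define P' where "P' = (P - D) \<union> (\<Union>I\<in>D. R I)"
  have part: "interval_partition P'"
    unfolding P'_def R_def using D partitions_points by (intro partition_refine[OF P(1)]) auto
  have "P - D = {I\<in>P. singleton_iv I} \<union> {I\<in>P. compact_iv I} \<union> {I\<in>P. halfopen_iv I} \<union> T"
    using partition_Un_kinds[OF P(1)] T(1) kinds_exclusive unfolding D_def closed_iv_def by blast
  then have "P' = ({I\<in>P. singleton_iv I} \<union> (\<Union>I\<in>D. R I)) \<union> {I\<in>P. compact_iv I} \<union>
      {I\<in>P. halfopen_iv I} \<union> T"
    unfolding P'_def by blast
  note kinds = members_by_kind[OF this]
  have R: "singleton_iv J" if "J \<in> R I" for I J using that by (auto simp: R_def singleton_iv_def)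
  have kinds: "{I\<in>P'. compact_iv I} = {I\<in>P. compact_iv I}"
    "{I\<in>P'. halfopen_iv I} = {I\<in>P. halfopen_iv I}" "{I\<in>P'. open_iv I} = T"
    by (rule kinds; use T(1) R in blast)+
  obtain I where "I \<in> D" using T(1) by (auto simp: D_def)
  then have "uncountable (R I)"
    using open_iv_topological(3)[OF D(2)] by (simp add: R_def countable_image_inj_eq)
  then have "uncountable P'"
    unfolding P'_def using \<open>I \<in> D\<close> by (meson UN_upper countable_subset sup.coboundedI2)
  \<comment> \<open>The general result on uncountable partitions supplies the number of singletons
    of the partition just built.\<close>
  then have "{I\<in>P'. singleton_iv I} \<approx> (UNIV :: real set)"
    by (rule uncountable_partition_singletons[OF part])
  then have "has_size_cv {I\<in>P'. singleton_iv I} Cont" by (simp add: has_size_cv_def)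
  moreover have "countable T"
    by (rule countable_subset[of T P]) (use T(1) \<open>countable P\<close> in auto)
  ultimately have "has_type P' \<theta>"
    using P T(2) unfolding \<theta> has_type_def prod.case kinds has_size_cv_Om by simp
  then show ?thesis using part by blast
qed

theorem theorem5:
  shows "(\<forall>P. interval_partition P \<longrightarrow>
            (countable P \<longrightarrow> (\<exists>\<theta>\<in>Q1. has_type P \<theta>)) \<and>
            (\<not> countable P \<longrightarrow> (\<exists>\<theta>\<in>Q2. has_type P \<theta>))) \<and>
         (\<forall>\<theta>\<in>Q1 \<union> Q2. \<exists>P. interval_partition P \<and> has_type P \<theta>)"
proof (intro conjI allI impI ballI)
  fix \<theta> assume "\<theta> \<in> Q1 \<union> Q2"
  then show "\<exists>P. interval_partition P \<and> has_type P \<theta>"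
    using Q1_realized Q2_realized by (elim UnE)
qed (simp_all add: countable_partition_type uncountable_partition_type)

end
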